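(* Let $D\ge1$ be an integer. There is a constant $C_D$, depending only on $D$, such that the following holds. Let $X=(X_1,\dots,X_n)$ be a random vector in $\mathbb{R}^n$ and $L>0$ a constant such that for every $p\ge2$ and every smooth function $g\colon\mathbb{R}^n\to\mathbb{R}$ with $g(X)$ integrable, $$\|g(X)-\mathbb{E}g(X)\|_p\le L\sqrt{p}\,\big\||\nabla g(X)|\big\|_p .$$ Let $f\colon\mathbb{R}\to\mathbb{R}$ be a $\mathcal{C}^D$ function such that $\|f^{(D)}\|_\infty<\infty$, and let $Z_f=f(X_1)+\cdots+f(X_n)$. Then for all $t>0$, $$\begin{aligned}\mathbb{P}(|Z_f-\mathbb{E}Z_f|\ge t)\le{}&2\exp\Big(-\frac{1}{C_D}\min\Big(\frac{t^2}{L^{2D}n\|f^{(D)}\|_\infty^2},\frac{t^{2/D}}{L^2\|f^{(D)}\|_\infty^{2/D}}\Big)\Big)\\&+2\exp\Big(-\frac{1}{C_D}\min_{1\le d\le D-1}\Big(\frac{t^2}{L^{2d}\sum_{i=1}^n(\mathbb{E}f^{(d)}(X_i))^2}\Big)\Big)\\&+2\exp\Big(-\frac{1}{C_D}\min_{2\le d\le D-1}\Big(\frac{t^{2/d}}{L^2\max_{i\le n}|\mathbb{E}f^{(d)}(X_i)|^{2/d}}\Big)\Big).\end{aligned}$$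
   Context: $|\cdot|$ is the Euclidean norm on $\mathbb{R}^n$; $\|Y\|_p=(\mathbb{E}|Y|^p)^{1/p}$ for a random variable $Y$; $f^{(d)}$ is the $d$-th derivative of $f$ and $\|\cdot\|_\infty$ is the supremum norm on $\mathbb{R}$. Conventions: a positive number divided by $0$ is $+\infty$, a minimum over an empty set is $+\infty$, and $\exp(-\infty)=0$. *)

theory Defs
  imports "HOL-Probability.Probability"
begin

text \<open>The dimension varies under the quantifier for the constant, so a point of \<open>R^n\<close> is
  an element of \<^term>\<open>topspace (Euclidean_space n)\<close>: a function \<open>x :: nat \<Rightarrow> real\<close> with
  \<open>x i = 0\<close> for \<open>i \<ge> n\<close>. Coordinates are numbered \<open>0, \<dots>, n - 1\<close>.\<close>

definition partial_deriv :: "nat \<Rightarrow> ((nat \<Rightarrow> real) \<Rightarrow> real) \<Rightarrow> (nat \<Rightarrow> real) \<Rightarrow> real" where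
  "partial_deriv i g x = deriv (\<lambda>s. g (x(i := s))) (x i)"

text \<open>\<open>C\<^sup>\<infinity>\<close>: every iterated partial derivative of \<open>g\<close> is continuous on \<open>R^n\<close> and can be
  differentiated again in every coordinate direction. The list \<open>is\<close> is the sequence of coordinates
  in which one differentiates; the empty list gives \<open>g\<close> itself.\<close>

definition smooth :: "nat \<Rightarrow> ((nat \<Rightarrow> real) \<Rightarrow> real) \<Rightarrow> bool" where
  "smooth n g \<longleftrightarrow> (\<forall>is. set is \<subseteq> {..<n} \<longrightarrow>
     continuous_map (Euclidean_space n) euclideanreal (foldr partial_deriv is g) \<and>
     (\<forall>x \<in> topspace (Euclidean_space n). \<forall>i<n.
        (\<lambda>s. foldr partial_deriv is g (x(i := s))) differentiable (at (x i))))"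

definition grad_norm :: "nat \<Rightarrow> ((nat \<Rightarrow> real) \<Rightarrow> real) \<Rightarrow> (nat \<Rightarrow> real) \<Rightarrow> real" where
  "grad_norm n g x = sqrt (\<Sum>i<n. (partial_deriv i g x)\<^sup>2)"

definition random_point :: "nat \<Rightarrow> (nat \<Rightarrow> 'a \<Rightarrow> real) \<Rightarrow> 'a \<Rightarrow> nat \<Rightarrow> real" where
  "random_point n X \<omega> = (\<lambda>i. if i < n then X i \<omega> else 0)"

text \<open>The norm \<open>(E|Y|^p)^(1/p)\<close> takes the value \<open>\<infinity>\<close> when the \<open>p\<close>-th moment is infinite.\<close>

definition Lp_norm :: "'a measure \<Rightarrow> real \<Rightarrow> ('a \<Rightarrow> real) \<Rightarrow> ennreal" where
  "Lp_norm M p Y =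
     (let m = \<integral>\<^sup>+ \<omega>. ennreal (\<bar>Y \<omega>\<bar> powr p) \<partial>M
      in if m = \<infinity> then \<infinity> else ennreal (enn2real m powr (1 / p)))"

definition moment_gradient_inequality ::
    "'a measure \<Rightarrow> nat \<Rightarrow> (nat \<Rightarrow> 'a \<Rightarrow> real) \<Rightarrow> real \<Rightarrow> bool" where
  "moment_gradient_inequality M n X L \<longleftrightarrow>
     (\<forall>p\<ge>2. \<forall>g. smooth n g \<longrightarrow> integrable M (\<lambda>\<omega>. g (random_point n X \<omega>)) \<longrightarrow>
        Lp_norm M p (\<lambda>\<omega>. g (random_point n X \<omega>) - (\<integral>\<omega>'. g (random_point n X \<omega>') \<partial>M))
          \<le> ennreal (L * sqrt p) * Lp_norm M p (\<lambda>\<omega>. grad_norm n g (random_point n X \<omega>)))"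

definition continuously_differentiable :: "nat \<Rightarrow> (real \<Rightarrow> real) \<Rightarrow> bool" where
  "continuously_differentiable D f \<longleftrightarrow>
     (\<forall>k<D. \<forall>x. (deriv ^^ k) f differentiable (at x)) \<and> continuous_on UNIV ((deriv ^^ D) f)"

text \<open>For functions with bounded range.\<close>

definition sup_norm :: "(real \<Rightarrow> real) \<Rightarrow> real" where
  "sup_norm h = (SUP x. \<bar>h x\<bar>)"

definition exp_ereal :: "ereal \<Rightarrow> ereal" where
  "exp_ereal x = (case x of ereal r \<Rightarrow> ereal (exp r) | PInfty \<Rightarrow> \<infinity> | MInfty \<Rightarrow> 0)"

text \<open>The arithmetic of \<^typ>\<open>ereal\<close> implements the conventions on degenerate terms: a positive
  number divided by \<open>0\<close> is \<open>\<infinity>\<close>, and the infimum over the empty set is \<open>\<infinity>\<close>. The infima below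
  range over finite sets, so they are minima.\<close>

definition concentration_bound ::
    "nat \<Rightarrow> real \<Rightarrow> 'a measure \<Rightarrow> nat \<Rightarrow> (nat \<Rightarrow> 'a \<Rightarrow> real) \<Rightarrow> real \<Rightarrow> (real \<Rightarrow> real) \<Rightarrow> real \<Rightarrow> bool"
  where
  "concentration_bound D C M n X L f t \<longleftrightarrow>
    (let Z = (\<lambda>\<omega>. \<Sum>i<n. f (X i \<omega>));
         S = sup_norm ((deriv ^^ D) f);
         m = (\<lambda>d i. \<integral>\<omega>. (deriv ^^ d) f (X i \<omega>) \<partial>M)
     in ereal (measure M {\<omega> \<in> space M. \<bar>Z \<omega> - (\<integral>\<omega>'. Z \<omega>' \<partial>M)\<bar> \<ge> t}) \<le>
          2 * exp_ereal (- (ereal (1 / C) *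
                min (ereal (t ^ 2) / ereal (L ^ (2 * D) * real n * S ^ 2))
                    (ereal (t powr (2 / real D)) / ereal (L ^ 2 * S powr (2 / real D)))))
        + 2 * exp_ereal (- (ereal (1 / C) *
                (INF d\<in>{1..D - 1}.
                   ereal (t ^ 2) / ereal (L ^ (2 * d) * (\<Sum>i<n. (m d i) ^ 2)))))
        + 2 * exp_ereal (- (ereal (1 / C) *
                (INF d\<in>{2..D - 1}.
                   ereal (t powr (2 / real d)) /
                   ereal (L ^ 2 * (MAX i\<in>{..<n}. \<bar>m d i\<bar> powr (2 / real d)))))))"

text \<open>\<open>C\<close> is admissible for \<open>D\<close> and all random vectors whose sample space has type \<open>'a\<close>.\<close>

definition admissible_constant :: "'a itself \<Rightarrow> nat \<Rightarrow> real \<Rightarrow> bool" where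
  "admissible_constant TA D C \<longleftrightarrow> C > 0 \<and>
     (\<forall>(M :: 'a measure) n X L f t.
        prob_space M \<longrightarrow> n \<ge> 1 \<longrightarrow> (\<forall>i<n. X i \<in> borel_measurable M) \<longrightarrow> L > 0 \<longrightarrow>
        moment_gradient_inequality M n X L \<longrightarrow>
        continuously_differentiable D f \<longrightarrow> bounded (range ((deriv ^^ D) f)) \<longrightarrow> t > 0 \<longrightarrow>
        concentration_bound D C M n X L f t)"

text \<open>The constant depends on \<open>D\<close> only, whereas \<open>\<exists>C. admissible_constant TYPE('a) D C\<close> alone would
  let it depend on the type \<open>'a\<close> of the sample space, and HOL cannot quantify over types inside a
  formula. Uniformity in \<open>'a\<close> is therefore expressed through one fixed type: there is an
  admissible constant for sample spaces of type \<^typ>\<open>nat \<Rightarrow> real\<close>, and every constant admissible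
  there is admissible for sample spaces of an arbitrary type \<open>'a\<close>.\<close>

end

theory Submission
  imports Defs
begin

text \<open>All norms below are taken for integers \<open>p \<ge> 2\<close>, and \<open>h = (\<Sum>i. f' (X i)\<^sup>2)\<^sup>1\<^sup>/\<^sup>2\<close>. The hypothesis
  for \<open>x \<mapsto> \<Sum>i. f (x i)\<close> bounds \<open>\<parallel>Z - E Z\<parallel>\<^sub>p\<close> by \<open>L \<surd>p \<parallel>h\<parallel>\<^sub>p\<close>. It is applied once more, to
  \<open>h\<close> itself, whose gradient is at most \<open>max\<^sub>i \<bar>f'' (X i)\<bar>\<close>; hence
  \<open>\<parallel>h\<parallel>\<^sub>p \<le> C (E h + L \<surd>p (\<Sum>i. E \<bar>f'' (X i)\<bar>\<^sup>p)\<^sup>1\<^sup>/\<^sup>p)\<close>. What remains is one-dimensional: iterating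
  the hypothesis for functions of a single coordinate, with exponent \<open>2\<close> for
  \<open>(E h)\<^sup>2 \<le> \<Sum>i. E f' (X i)\<^sup>2\<close> and with exponent \<open>p\<close> for \<open>E \<bar>f'' (X i)\<bar>\<^sup>p\<close>, produces the means
  of \<open>f\<^sup>d (X i)\<close>, the \<open>d\<close>-th derivative, and finally the supremum norm of \<open>f\<^sup>D\<close>. The resulting
  \<open>p\<close>-norm of the vector of means is interpolated between its Euclidean and its maximum norm, and
  Markov's inequality with optimal \<open>p\<close> gives the tail bound.

  The hypothesis is available for smooth functions only. A \<open>C\<^sup>1\<close> function of polynomial growth is
  approximated, in a weighted supremum norm, by antiderivatives of rational functions.\<close>

section \<open>Smooth functions\<close>

lemma continuous_on_UNIV_if_DERIV:
  assumes "\<And>x. (f has_real_derivative f' x) (at x)"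
  shows "continuous_on UNIV f"
  using assms by (meson DERIV_isCont continuous_at_imp_continuous_on)

text \<open>A greatest fixed point takes the place of a quantifier over the order of the derivative:
  membership follows by exhibiting a class of functions that is closed under
  differentiation.\<close>

coinductive smooth_on_line :: "(real \<Rightarrow> real) \<Rightarrow> bool" where
  smooth_on_lineI: "(\<And>x. (f has_real_derivative f' x) (at x)) \<Longrightarrow> smooth_on_line f' \<Longrightarrow> smooth_on_line f"

lemma smooth_on_lineE:
  assumes "smooth_on_line f"
  obtains f' where "\<And>x. (f has_real_derivative f' x) (at x)" "smooth_on_line f'"
  using assms by (rule smooth_on_line.cases) blast

text \<open>By the quotient rule the derivative of \<open>p / q ^ N\<close> has the form
  \<open>r / q ^ Suc N\<close> with the same \<open>q\<close>. For fixed \<open>q\<close> these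
  quotients are therefore closed under differentiation, and coinduction applies.\<close>

lemma smooth_on_line_quotient:
  assumes "\<And>x. poly q x \<noteq> 0"
  shows "smooth_on_line (\<lambda>x. poly p x / poly q x ^ N)"
proof -
  define S where "S f \<longleftrightarrow> (\<exists>p N. f = (\<lambda>x. poly p x / poly q x ^ N))" for f
  have "S (\<lambda>x. poly p x / poly q x ^ N)" unfolding S_def by blast
  then show ?thesis
  proof (rule smooth_on_line.coinduct[of S])
    fix f assume "S f"
    then obtain p N where f: "f = (\<lambda>x. poly p x / poly q x ^ N)" unfolding S_def by blast
    let ?r = "pderiv p * q - smult (of_nat N) (p * pderiv q)"
    have "(f has_real_derivative poly ?r x / poly q x ^ Suc N) (at x)" for x
    proof -
      \<comment> \<open>The power rule produces the exponent \<open>N - 1\<close>, a subtraction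
        that is truncated at \<open>N = 0\<close>.\<close>
      have "N = 0 \<or> poly q x ^ N = poly q x * poly q x ^ (N - 1)"
        by (cases N) auto
      then show ?thesis unfolding f using assms[of x]
        by (auto intro!: derivative_eq_intros simp: divide_simps power2_eq_square)
           (simp_all add: algebra_simps)
    qed
    moreover have "S (\<lambda>x. poly ?r x / poly q x ^ Suc N)" unfolding S_def by blast
    ultimately show "\<exists>g g'. f = g \<and> (\<forall>x. (g has_real_derivative g' x) (at x)) \<and> (S g' \<or> smooth_on_line g')"
      by (intro exI[of _ f] exI[of _ "\<lambda>x. poly ?r x / poly q x ^ Suc N"]) simp
  qed
qed

lemma smooth_on_line_poly: "smooth_on_line (poly p)"
  using smooth_on_line_quotient[of 1 p 0] by simp

text \<open>A syntactic class closed under \<open>partial_deriv\<close> and large enough for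
  \<open>\<Sum>i. F (x i)\<close> and for the regularised Euclidean norm
  \<open>(e + (\<Sum>i. F (x i) * F (x i))) powr (1 / 2)\<close>. Bases of powers are required to be
  positive everywhere, so that the power rule for \<open>powr\<close> applies.\<close>

inductive smooth_term :: "((nat \<Rightarrow> real) \<Rightarrow> real) \<Rightarrow> bool" where
  coord: "smooth_on_line f \<Longrightarrow> smooth_term (\<lambda>x. f (x i))"
| const: "smooth_term (\<lambda>x. c)"
| add: "smooth_term g \<Longrightarrow> smooth_term h \<Longrightarrow> smooth_term (\<lambda>x. g x + h x)"
| mult: "smooth_term g \<Longrightarrow> smooth_term h \<Longrightarrow> smooth_term (\<lambda>x. g x * h x)"
| pow: "smooth_term g \<Longrightarrow> (\<And>x. g x > 0) \<Longrightarrow> smooth_term (\<lambda>x. g x powr s)"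

lemma smooth_term_sum:
  assumes "\<And>i. i \<in> I \<Longrightarrow> smooth_term (g i)"
  shows "smooth_term (\<lambda>x. \<Sum>i\<in>I. g i x)"
  using assms by (induction I rule: infinite_finite_induct) (auto intro: smooth_term.intros)

lemma smooth_term_deriv:
  assumes "smooth_term g"
  shows "\<exists>g'. smooth_term g' \<and> (\<forall>x. ((\<lambda>s. g (x(i := s))) has_real_derivative g' x) (at (x i)))"
  using assms
proof induction
  case (coord f j)
  then obtain f' where f': "\<And>x. (f has_real_derivative f' x) (at x)" "smooth_on_line f'"
    by (metis smooth_on_lineE)
  show ?case
  proof (cases "i = j")
    case True
    show ?thesis
      by (rule exI[of _ "\<lambda>x. f' (x j)"]) (use f' True in \<open>auto intro: smooth_term.intros\<close>)
  next
    case False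
    show ?thesis
      by (rule exI[of _ "\<lambda>x. 0"]) (use False in \<open>auto intro: smooth_term.intros\<close>)
  qed
next
  case (const c)
  show ?case by (rule exI[of _ "\<lambda>x. 0"]) (auto intro: smooth_term.intros)
next
  case (add g h)
  then obtain g' h' where *: "smooth_term g'" "smooth_term h'"
    "\<And>x. ((\<lambda>s. g (x(i := s))) has_real_derivative g' x) (at (x i))"
    "\<And>x. ((\<lambda>s. h (x(i := s))) has_real_derivative h' x) (at (x i))" by blast
  show ?case
    by (rule exI[of _ "\<lambda>x. g' x + h' x"])
       (intro conjI allI smooth_term.intros DERIV_add *)
next
  case (mult g h)
  then obtain g' h' where *: "smooth_term g'" "smooth_term h'"
    "\<And>x. ((\<lambda>s. g (x(i := s))) has_real_derivative g' x) (at (x i))"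
    "\<And>x. ((\<lambda>s. h (x(i := s))) has_real_derivative h' x) (at (x i))" by blast
  show ?case
  proof (intro exI[of _ "\<lambda>x. g' x * h x + h' x * g x"] conjI allI)
    show "((\<lambda>s. g (x(i := s)) * h (x(i := s))) has_real_derivative g' x * h x + h' x * g x) (at (x i))" for x
      using DERIV_mult[OF *(3)[of x] *(4)[of x]] by simp
  qed (intro smooth_term.intros * mult)+
next
  case (pow g s)
  then obtain g' where *: "smooth_term g'"
    "\<And>x. ((\<lambda>s. g (x(i := s))) has_real_derivative g' x) (at (x i))" by blast
  have "((\<lambda>t. g (x(i := t)) powr s) has_real_derivative s * g x powr (s - 1) * g' x) (at (x i))" for x
    using DERIV_fun_powr[OF *(2)[of x], of s] pow(2) by simp
  moreover have "smooth_term (\<lambda>x. s * g x powr (s - 1) * g' x)"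
    by (intro smooth_term.intros * pow)
  ultimately show ?case by blast
qed

lemma smooth_term_partial_deriv:
  assumes "smooth_term g"
  shows "smooth_term (partial_deriv i g)"
proof -
  obtain g' where g': "smooth_term g'"
    "\<And>x. ((\<lambda>s. g (x(i := s))) has_real_derivative g' x) (at (x i))"
    using smooth_term_deriv[OF assms] by blast
  have "partial_deriv i g = g'"
    unfolding partial_deriv_def using g'(2) by (auto intro!: DERIV_imp_deriv)
  then show ?thesis using g' by simp
qed

lemma smooth_term_continuous: "smooth_term g \<Longrightarrow> continuous_on UNIV g"
proof (induction rule: smooth_term.induct)
  case (coord f i)
  then obtain f' where "\<And>x. (f has_real_derivative f' x) (at x)"
    by (metis smooth_on_lineE)
  then have "continuous_on UNIV f"
    by (rule continuous_on_UNIV_if_DERIV)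
  then show ?case
    by (rule continuous_on_compose2) (auto intro: continuous_on_product_coordinates)
next
  case (pow g s)
  have "g x \<noteq> 0" for x using pow(2)[of x] by simp
  then show ?case by (intro continuous_intros pow) auto
qed (auto intro!: continuous_intros)

text \<open>Closure under \<open>partial_deriv\<close> puts every iterated partial derivative back
  into the class. Its members are continuous on all of \<open>nat \<Rightarrow> real\<close>, hence
  on the subspace \<open>Euclidean_space n\<close>.\<close>

lemma smooth_term_imp_smooth:
  assumes "smooth_term g"
  shows "smooth n g"
proof -
  have *: "smooth_term (foldr partial_deriv is g)" for "is"
    by (induction "is") (auto intro: assms smooth_term_partial_deriv)
  have "continuous_map (Euclidean_space n) euclideanreal (foldr partial_deriv is g)" for "is"
    unfolding Euclidean_space_def euclidean_product_topology
    using smooth_term_continuous[OF *] by (intro continuous_map_from_subtopology) simp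
  moreover have "(\<lambda>s. foldr partial_deriv is g (x(i := s))) differentiable (at (x i))" for "is" x i
    using smooth_term_deriv[OF *] unfolding real_differentiable_def by blast
  ultimately show ?thesis unfolding smooth_def by blast
qed

section \<open>Approximation of functions of polynomial growth\<close>

lemma one_le_weight: "(1::real) \<le> (1 + x\<^sup>2) ^ m"
  by (simp add: one_le_power)

text \<open>The circle is the one-point compactification of the line under stereographic projection, and
  polynomials on the circle become rational functions with denominator \<open>(1 + x\<^sup>2)\<^sup>N\<close>.\<close>

lemma rational_circle_function:
  assumes "real_polynomial_function (g :: complex \<Rightarrow> real)"
  shows "\<exists>p N. \<forall>x. g (Complex ((1 - x\<^sup>2) / (1 + x\<^sup>2)) (2 * x / (1 + x\<^sup>2))) = poly p x / (1 + x\<^sup>2) ^ N"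
  using assms
proof induction
  case (linear f)
  interpret bounded_linear f by fact
  have "Complex a b = a *\<^sub>R 1 + b *\<^sub>R \<i>" for a b
    by (simp add: complex_eq_iff)
  then have "f (Complex a b) = a * f 1 + b * f \<i>" for a b
    by (simp add: add scaleR)
  then have "f (Complex ((1 - x\<^sup>2) / (1 + x\<^sup>2)) (2 * x / (1 + x\<^sup>2))) =
      poly [:f 1, 2 * f \<i>, - f 1:] x / (1 + x\<^sup>2) ^ 1" for x
    by (simp add: add_divide_distrib[symmetric] flip: diff_divide_distrib) (simp add: algebra_simps power2_eq_square add_divide_distrib diff_divide_distrib)
  then show ?case by blast
next
  case (const c)
  have "c = poly [:c:] x / (1 + x\<^sup>2) ^ 0" for x by simp
  then show ?case by blast
next
  case (add f g)
  then obtain p M q N where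
    "\<And>x. f (Complex ((1 - x\<^sup>2) / (1 + x\<^sup>2)) (2 * x / (1 + x\<^sup>2))) = poly p x / (1 + x\<^sup>2) ^ M"
    "\<And>x. g (Complex ((1 - x\<^sup>2) / (1 + x\<^sup>2)) (2 * x / (1 + x\<^sup>2))) = poly q x / (1 + x\<^sup>2) ^ N"
    by blast
  moreover have "poly p x / (1 + x\<^sup>2) ^ M + poly q x / (1 + x\<^sup>2) ^ N =
      poly (p * [:1, 0, 1:] ^ N + q * [:1, 0, 1:] ^ M) x / (1 + x\<^sup>2) ^ (M + N)" for x
  proof -
    have "1 + x\<^sup>2 \<noteq> 0" by (smt (verit) zero_le_power2)
    then show ?thesis
      by (simp add: add_frac_eq power_add power2_eq_square)
  qed
  ultimately show ?case
    by (intro exI[of _ "p * [:1, 0, 1:] ^ N + q * [:1, 0, 1:] ^ M"] exI[of _ "M + N"]) (simp only: simp_thms)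
next
  case (mult f g)
  then obtain p M q N where
    "\<And>x. f (Complex ((1 - x\<^sup>2) / (1 + x\<^sup>2)) (2 * x / (1 + x\<^sup>2))) = poly p x / (1 + x\<^sup>2) ^ M"
    "\<And>x. g (Complex ((1 - x\<^sup>2) / (1 + x\<^sup>2)) (2 * x / (1 + x\<^sup>2))) = poly q x / (1 + x\<^sup>2) ^ N"
    by blast
  moreover have "poly p x / (1 + x\<^sup>2) ^ M * (poly q x / (1 + x\<^sup>2) ^ N) =
      poly (p * q) x / (1 + x\<^sup>2) ^ (M + N)" for x
    by (simp add: power_add)
  ultimately show ?case
    by (intro exI[of _ "p * q"] exI[of _ "M + N"]) (simp only: simp_thms)
qed

text \<open>The decay of \<open>f\<close> makes its transplant to the circle continuous with value 0
  at the point at infinity. Stone-Weierstrass gives a polynomial on the circle, whose pullback to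
  the line is the rational function.\<close>

lemma rational_approximation_vanishing:
  fixes f :: "real \<Rightarrow> real"
  assumes "continuous_on UNIV f" "\<And>x. \<bar>f x\<bar> \<le> B / (1 + x\<^sup>2)" "e > 0"
  obtains p N where "\<And>x. \<bar>f x - poly p x / (1 + x\<^sup>2) ^ N\<bar> < e"
proof -
  \<comment> \<open>\<open>Im z / (1 + Re z)\<close> is the stereographic projection from
    \<open>-1\<close>, the point that corresponds to infinity.\<close>
  define F where "F z = (if z = -1 then 0 else f (Im z / (1 + Re z)))" for z
  have pos: "1 + x\<^sup>2 > 0" for x :: real by (smt (verit) zero_le_power2)
  have ne: "1 + Re z > 0" if "z \<in> sphere 0 1" "z \<noteq> -1" for z :: complex
  proof -
    have n: "norm z = 1" using that by simp
    then have "- 1 \<le> Re z" using abs_Re_le_cmod[of z] by linarith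
    moreover have "Re z \<noteq> -1"
    proof
      assume "Re z = -1"
      then have "(Im z)\<^sup>2 = 0" using n cmod_power2[of z] by simp
      then show False using \<open>Re z = -1\<close> that by (auto simp: complex_eq_iff)
    qed
    ultimately show ?thesis by linarith
  qed
  \<comment> \<open>Under the projection \<open>1 / (1 + x\<^sup>2)\<close> becomes
    \<open>(1 + Re z) / 2\<close>, which tends to 0 at \<open>-1\<close>; continuity of
    \<open>F\<close> at that point rests on this bound.\<close>
  have bound: "\<bar>F z\<bar> \<le> B * ((1 + Re z) / 2)" if z: "z \<in> sphere 0 1" for z
  proof (cases "z = -1")
    case True then show ?thesis by (simp add: F_def)
  next
    case False
    have "(Re z)\<^sup>2 + (Im z)\<^sup>2 = 1" using z cmod_power2[of z] by simp
    then have "(1 + Re z)\<^sup>2 + (Im z)\<^sup>2 = 2 * (1 + Re z)"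
      by (simp add: power2_sum)
    moreover have "1 + (Im z / (1 + Re z))\<^sup>2 = ((1 + Re z)\<^sup>2 + (Im z)\<^sup>2) / (1 + Re z)\<^sup>2"
      using ne[OF z False] by (simp add: add_divide_distrib power_divide)
    ultimately have "1 + (Im z / (1 + Re z))\<^sup>2 = 2 / (1 + Re z)"
      using ne[OF z False] by (simp only: power2_eq_square mult_divide_mult_cancel_right)
    then show ?thesis using assms(2)[of "Im z / (1 + Re z)"] False by (simp add: F_def)
  qed
  have "continuous_on (sphere 0 1) F"
    unfolding continuous_on_def
  proof
    fix z :: complex assume z: "z \<in> sphere 0 1"
    show "(F \<longlongrightarrow> F z) (at z within sphere 0 1)"
    proof (cases "z = -1")
      case True
      have "((\<lambda>w. B * ((1 + Re w) / 2)) \<longlongrightarrow> B * ((1 + Re z) / 2)) (at z within sphere 0 1)"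
        by (intro tendsto_intros) auto
      then have "(F \<longlongrightarrow> 0) (at z within sphere 0 1)"
        using bound True by (intro Lim_null_comparison[of F "\<lambda>w. B * ((1 + Re w) / 2)"])
          (auto simp: eventually_at_filter)
      then show ?thesis using True by (simp add: F_def)
    next
      case False
      have "isCont f y" for y using assms(1) by (simp add: continuous_on_eq_continuous_at)
      then have "((\<lambda>w. f (Im w / (1 + Re w))) \<longlongrightarrow> f (Im z / (1 + Re z))) (at z within sphere 0 1)"
        using ne[OF z False] by (intro isCont_tendsto_compose[of _ f] tendsto_intros) auto
      moreover have "eventually (\<lambda>w. w \<noteq> -1) (at z within sphere 0 1)"
        using False by (intro tendsto_imp_eventually_ne[OF tendsto_ident_at])
      then have "eventually (\<lambda>w. F w = f (Im w / (1 + Re w))) (at z within sphere 0 1)"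
        by eventually_elim (simp add: F_def)
      ultimately show ?thesis using False
        by (simp add: F_def[of z] filterlim_cong)
    qed
  qed
  then obtain g where g: "real_polynomial_function g" "\<And>z. z \<in> sphere 0 1 \<Longrightarrow> \<bar>F z - g z\<bar> < e"
    using Stone_Weierstrass_real_polynomial_function[OF compact_sphere _ \<open>e > 0\<close>] by blast
  obtain p N where p: "\<And>x. g (Complex ((1 - x\<^sup>2) / (1 + x\<^sup>2)) (2 * x / (1 + x\<^sup>2))) = poly p x / (1 + x\<^sup>2) ^ N"
    using rational_circle_function[OF g(1)] by blast
  have "\<bar>f x - poly p x / (1 + x\<^sup>2) ^ N\<bar> < e" for x
  proof -
    let ?z = "Complex ((1 - x\<^sup>2) / (1 + x\<^sup>2)) (2 * x / (1 + x\<^sup>2))"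
    have "((1 - x\<^sup>2) / (1 + x\<^sup>2))\<^sup>2 + (2 * x / (1 + x\<^sup>2))\<^sup>2 = 1"
      using pos[of x] by (simp add: divide_simps power_divide) (simp add: algebra_simps power2_eq_square)
    then have "?z \<in> sphere 0 1" by (simp add: cmod_def)
    moreover have r: "1 + (1 - x\<^sup>2) / (1 + x\<^sup>2) = 2 / (1 + x\<^sup>2)"
      using pos[of x] by (simp add: divide_simps)
    then have "?z \<noteq> -1" using pos[of x] by (auto simp: complex_eq_iff)
    then have "F ?z = f x" using pos[of x] by (simp add: F_def r)
    ultimately show ?thesis using g(2)[of ?z] p by simp
  qed
  then show thesis using that by blast
qed

text \<open>The derivative is approximated first and then integrated, so that one approximation
  controls both functions. Dividing \<open>f'\<close> by the weight to the power
  \<open>m + 1\<close> produces the decay needed for rational approximation. Integrating from 0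
  costs one more factor of the weight, since
  \<open>\<bar>x\<bar> \<le> 1 + x\<^sup>2\<close>.\<close>

lemma smooth_approximation:
  fixes f f' :: "real \<Rightarrow> real"
  assumes f: "\<And>x. (f has_real_derivative f' x) (at x)" and cont: "continuous_on UNIV f'"
    and growth: "\<And>x. \<bar>f' x\<bar> \<le> B * (1 + x\<^sup>2) ^ m" and e: "e > 0"
  obtains F F' where "smooth_on_line F" "smooth_on_line F'" "\<And>x. (F has_real_derivative F' x) (at x)"
    "\<And>x. \<bar>F x - f x\<bar> \<le> e * (1 + x\<^sup>2) ^ (m + 2)" "\<And>x. \<bar>F' x - f' x\<bar> \<le> e * (1 + x\<^sup>2) ^ (m + 2)"
proof -
  have pos: "1 + x\<^sup>2 > 0" for x :: real by (smt (verit) zero_le_power2)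
  have "\<bar>f' x / (1 + x\<^sup>2) ^ (m + 1)\<bar> \<le> B / (1 + x\<^sup>2)" for x
    using growth[of x] pos[of x] by (simp add: abs_divide divide_simps mult.commute)
  moreover have "continuous_on UNIV (\<lambda>x. f' x / (1 + x\<^sup>2) ^ (m + 1))"
    using pos by (intro continuous_intros cont) (auto simp: less_imp_neq[symmetric])
  ultimately obtain p N where p: "\<And>x. \<bar>f' x / (1 + x\<^sup>2) ^ (m + 1) - poly p x / (1 + x\<^sup>2) ^ N\<bar> < e"
    using rational_approximation_vanishing[OF _ _ e] by blast
  define F' where "F' x = poly ([:1, 0, 1:] ^ (m + 1) * p) x / poly [:1, 0, 1:] x ^ N" for x
  have F'_eq: "F' x = (1 + x\<^sup>2) ^ (m + 1) * (poly p x / (1 + x\<^sup>2) ^ N)" for x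
    by (simp add: F'_def power2_eq_square algebra_simps add_divide_distrib)
  have "poly [:1, 0, 1:] x \<noteq> 0" for x :: real
    using pos[of x] by (simp add: power2_eq_square)
  then have smooth: "smooth_on_line F'"
    unfolding F'_def by (rule smooth_on_line_quotient)
  then have "continuous_on UNIV F'"
    by (rule smooth_on_lineE) (meson DERIV_isCont continuous_at_imp_continuous_on)
  then obtain F0 where F0: "\<And>x. (F0 has_real_derivative F' x) (at x)"
    using einterval_antiderivative[of "-\<infinity>" "\<infinity>" F']
    by (auto simp: continuous_on_eq_continuous_at has_real_derivative_iff_has_vector_derivative)
  \<comment> \<open>Normalised to \<open>F 0 = f 0\<close>, so that the mean value theorem between 0
    and \<open>x\<close> bounds \<open>F - f\<close> by the error of the derivatives.\<close>
  define F where "F x = F0 x - F0 0 + f 0" for x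
  have F: "(F has_real_derivative F' x) (at x)" for x
    unfolding F_def by (auto intro!: derivative_eq_intros F0)
  have d': "\<bar>F' x - f' x\<bar> \<le> e * (1 + x\<^sup>2) ^ (m + 1)" for x
  proof -
    have "F' x - f' x = (- ((1 + x\<^sup>2) ^ (m + 1))) * (f' x / (1 + x\<^sup>2) ^ (m + 1) - poly p x / (1 + x\<^sup>2) ^ N)"
      using pos[of x] unfolding F'_eq by (simp add: right_diff_distrib)
    then have "\<bar>F' x - f' x\<bar> = (1 + x\<^sup>2) ^ (m + 1) * \<bar>f' x / (1 + x\<^sup>2) ^ (m + 1) - poly p x / (1 + x\<^sup>2) ^ N\<bar>"
      using pos[of x] by (simp only: abs_mult) simp
    also have "\<dots> \<le> (1 + x\<^sup>2) ^ (m + 1) * e"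
      using p[of x] pos[of x] by (intro mult_left_mono) auto
    finally show ?thesis by (simp add: mult.commute)
  qed
  have d: "\<bar>F x - f x\<bar> \<le> e * (1 + x\<^sup>2) ^ (m + 2)" for x
  proof -
    have "\<exists>z. \<bar>z\<bar> \<le> \<bar>x\<bar> \<and> F x - f x = x * (F' z - f' z)"
    proof -
      have D: "((\<lambda>x. F x - f x) has_real_derivative F' z - f' z) (at z)" for z
        by (intro DERIV_diff F f)
      have 0: "F 0 - f 0 = 0" by (simp add: F_def)
      consider "x > 0" | "x < 0" | "x = 0" by linarith
      then show ?thesis
      proof cases
        case 1
        then obtain z where "0 < z" "z < x" "F x - f x - (F 0 - f 0) = (x - 0) * (F' z - f' z)"
          using MVT2[of 0 x "\<lambda>x. F x - f x" "\<lambda>z. F' z - f' z"] D by auto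
        then show ?thesis using 0 by (intro exI[of _ z]) auto
      next
        case 2
        then obtain z where "x < z" "z < 0" "F 0 - f 0 - (F x - f x) = (0 - x) * (F' z - f' z)"
          using MVT2[of x 0 "\<lambda>x. F x - f x" "\<lambda>z. F' z - f' z"] D by auto
        then show ?thesis using 0 by (intro exI[of _ z]) auto
      next
        case 3 then show ?thesis using 0 by auto
      qed
    qed
    then obtain z where z: "\<bar>z\<bar> \<le> \<bar>x\<bar>" "F x - f x = x * (F' z - f' z)" by blast
    have "\<bar>F x - f x\<bar> = \<bar>x\<bar> * \<bar>F' z - f' z\<bar>" unfolding z(2) by (rule abs_mult)
    also have "\<dots> \<le> (1 + x\<^sup>2) * (e * (1 + x\<^sup>2) ^ (m + 1))"
    proof (intro mult_mono)
      have "0 \<le> (\<bar>x\<bar> - 1)\<^sup>2" by simp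
      then show "\<bar>x\<bar> \<le> 1 + x\<^sup>2" by (simp add: power2_diff)
      have "z\<^sup>2 \<le> x\<^sup>2" using z(1) by (simp add: abs_le_square_iff)
      then have "e * (1 + z\<^sup>2) ^ (m + 1) \<le> e * (1 + x\<^sup>2) ^ (m + 1)"
        using e by (intro mult_left_mono power_mono) auto
      then show "\<bar>F' z - f' z\<bar> \<le> e * (1 + x\<^sup>2) ^ (m + 1)" using d'[of z] by linarith
    qed (use e in auto)
    finally show ?thesis by (simp add: algebra_simps)
  qed
  have "e * (1 + x\<^sup>2) ^ (m + 1) \<le> e * (1 + x\<^sup>2) ^ (m + 2)" for x
    using e by (intro mult_left_mono power_increasing) auto
  then have "\<bar>F' x - f' x\<bar> \<le> e * (1 + x\<^sup>2) ^ (m + 2)" for x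
    using d'[of x] by (meson order_trans)
  with d F smooth smooth_on_lineI[OF F smooth] show thesis
    by (intro that)
qed

text \<open>A mean value estimate from 0, at the cost of one power of the weight. Starting from the
  bounded top derivative, it yields polynomial growth for all lower ones.\<close>

lemma polynomial_growth_antiderivative:
  fixes f f' :: "real \<Rightarrow> real"
  assumes f: "\<And>x. (f has_real_derivative f' x) (at x)"
    and growth: "\<And>x. \<bar>f' x\<bar> \<le> B * (1 + x\<^sup>2) ^ m"
  shows "\<exists>A k. \<forall>x. \<bar>f x\<bar> \<le> A * (1 + x\<^sup>2) ^ k"
proof -
  have B: "0 \<le> B" using growth[of 0] by simp
  have "\<bar>f x\<bar> \<le> (\<bar>f 0\<bar> + B) * (1 + x\<^sup>2) ^ (m + 1)" for x
  proof -
    have "norm (f x - f 0) \<le> B * (1 + x\<^sup>2) ^ m * norm (x - 0)"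
    proof (rule field_differentiable_bound[where S = "{-\<bar>x\<bar>..\<bar>x\<bar>}" and f' = f'])
      fix z assume "z \<in> {-\<bar>x\<bar>..\<bar>x\<bar>}"
      then have "z\<^sup>2 \<le> x\<^sup>2" by (simp add: abs_le_square_iff[symmetric] abs_le_iff)
      then have "B * (1 + z\<^sup>2) ^ m \<le> B * (1 + x\<^sup>2) ^ m"
        using B by (intro mult_left_mono power_mono) auto
      then show "norm (f' z) \<le> B * (1 + x\<^sup>2) ^ m" using growth[of z] by simp
    qed (auto intro: has_field_derivative_at_within f)
    moreover have "\<bar>x\<bar> \<le> 1 + x\<^sup>2"
    proof -
      have "0 \<le> (\<bar>x\<bar> - 1)\<^sup>2" by simp
      then show ?thesis by (simp add: power2_diff)
    qed
    then have "B * (1 + x\<^sup>2) ^ m * \<bar>x\<bar> \<le> B * (1 + x\<^sup>2) ^ m * (1 + x\<^sup>2)"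
      using B by (intro mult_left_mono) auto
    moreover have "\<bar>f 0\<bar> * 1 \<le> \<bar>f 0\<bar> * (1 + x\<^sup>2) ^ (m + 1)"
      by (intro mult_left_mono one_le_weight) auto
    ultimately show ?thesis by (simp add: algebra_simps)
  qed
  then show ?thesis by blast
qed

section \<open>Moments of the coordinates\<close>

lemma abs_add_power_le:
  fixes a b :: real
  shows "\<bar>a + b\<bar> ^ p \<le> 2 ^ p * (\<bar>a\<bar> ^ p + \<bar>b\<bar> ^ p)"
proof -
  have "\<bar>a + b\<bar> ^ p \<le> (2 * max \<bar>a\<bar> \<bar>b\<bar>) ^ p"
    by (intro power_mono) auto
  also have "\<dots> = 2 ^ p * (max \<bar>a\<bar> \<bar>b\<bar>) ^ p" by (rule power_mult_distrib)
  also have "\<dots> \<le> 2 ^ p * (\<bar>a\<bar> ^ p + \<bar>b\<bar> ^ p)"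
    by (intro mult_left_mono) (auto simp: max_def)
  finally show ?thesis .
qed

text \<open>Stability under sums, products and domination lets integrability be settled once for all
  exponents. Natural exponents suffice, because all moments compared below have integer
  order.\<close>

definition all_moments :: "'a measure \<Rightarrow> ('a \<Rightarrow> real) \<Rightarrow> bool" where
  "all_moments M Y \<longleftrightarrow> Y \<in> borel_measurable M \<and> (\<forall>k. integrable M (\<lambda>\<omega>. \<bar>Y \<omega>\<bar> ^ k))"

lemma all_moments_measurable: "all_moments M Y \<Longrightarrow> Y \<in> borel_measurable M"
  by (simp add: all_moments_def)

lemma all_moments_integrable_power: "all_moments M Y \<Longrightarrow> integrable M (\<lambda>\<omega>. \<bar>Y \<omega>\<bar> ^ k)"
  by (simp add: all_moments_def)

lemma all_moments_integrable:
  assumes "all_moments M Y" shows "integrable M Y"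
  using assms all_moments_integrable_power[OF assms, of 1]
  by (auto simp: all_moments_def intro: integrable_abs_cancel)

lemma all_moments_dominated:
  assumes "all_moments M Z" "Y \<in> borel_measurable M" "\<And>\<omega>. \<omega> \<in> space M \<Longrightarrow> \<bar>Y \<omega>\<bar> \<le> \<bar>Z \<omega>\<bar>"
  shows "all_moments M Y"
  unfolding all_moments_def
proof (intro conjI allI)
  fix k
  show "integrable M (\<lambda>\<omega>. \<bar>Y \<omega>\<bar> ^ k)"
    by (rule Bochner_Integration.integrable_bound[OF all_moments_integrable_power[OF assms(1), of k]])
       (use assms in \<open>auto intro!: power_mono\<close>)
qed fact

lemma all_moments_add:
  assumes "all_moments M Y" "all_moments M Z"
  shows "all_moments M (\<lambda>\<omega>. Y \<omega> + Z \<omega>)"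
  unfolding all_moments_def
proof (intro conjI allI)
  note [measurable] = assms[THEN all_moments_measurable]
  show "(\<lambda>\<omega>. Y \<omega> + Z \<omega>) \<in> borel_measurable M" by measurable
  fix k
  have "integrable M (\<lambda>\<omega>. 2 ^ k * (\<bar>Y \<omega>\<bar> ^ k + \<bar>Z \<omega>\<bar> ^ k))"
    by (intro integrable_mult_right Bochner_Integration.integrable_add all_moments_integrable_power assms)
  then show "integrable M (\<lambda>\<omega>. \<bar>Y \<omega> + Z \<omega>\<bar> ^ k)"
    by (rule Bochner_Integration.integrable_bound) (auto simp: abs_add_power_le)
qed

text \<open>The arithmetic-geometric mean inequality trades the \<open>k\<close>-th moment of the
  product for the \<open>2 * k\<close>-th moments of the factors.\<close>

lemma all_moments_mult:
  assumes "all_moments M Y" "all_moments M Z"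
  shows "all_moments M (\<lambda>\<omega>. Y \<omega> * Z \<omega>)"
  unfolding all_moments_def
proof (intro conjI allI)
  note [measurable] = assms[THEN all_moments_measurable]
  show "(\<lambda>\<omega>. Y \<omega> * Z \<omega>) \<in> borel_measurable M" by measurable
  fix k
  have "integrable M (\<lambda>\<omega>. \<bar>Y \<omega>\<bar> ^ (2 * k) + \<bar>Z \<omega>\<bar> ^ (2 * k))"
    by (intro Bochner_Integration.integrable_add all_moments_integrable_power assms)
  then show "integrable M (\<lambda>\<omega>. \<bar>Y \<omega> * Z \<omega>\<bar> ^ k)"
  proof (rule Bochner_Integration.integrable_bound)
    have "\<bar>Y \<omega> * Z \<omega>\<bar> ^ k \<le> \<bar>Y \<omega>\<bar> ^ (2 * k) + \<bar>Z \<omega>\<bar> ^ (2 * k)" for \<omega>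
    proof -
      have "2 * (\<bar>Y \<omega>\<bar> ^ k * \<bar>Z \<omega>\<bar> ^ k) \<le> (\<bar>Y \<omega>\<bar> ^ k)\<^sup>2 + (\<bar>Z \<omega>\<bar> ^ k)\<^sup>2"
        using sum_squares_bound[of "\<bar>Y \<omega>\<bar> ^ k" "\<bar>Z \<omega>\<bar> ^ k"] by (simp only: mult.assoc)
      moreover have "0 \<le> \<bar>Y \<omega>\<bar> ^ k * \<bar>Z \<omega>\<bar> ^ k" by simp
      ultimately have "\<bar>Y \<omega>\<bar> ^ k * \<bar>Z \<omega>\<bar> ^ k \<le> (\<bar>Y \<omega>\<bar> ^ k)\<^sup>2 + (\<bar>Z \<omega>\<bar> ^ k)\<^sup>2"
        by linarith
      then show ?thesis
        by (simp only: abs_mult power_mult_distrib mult.commute[of 2] power_mult)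
    qed
    then show "AE \<omega> in M. norm (\<bar>Y \<omega> * Z \<omega>\<bar> ^ k) \<le> norm (\<bar>Y \<omega>\<bar> ^ (2 * k) + \<bar>Z \<omega>\<bar> ^ (2 * k))"
      by simp
  qed simp
qed

lemma all_moments_const:
  assumes "finite_measure M" shows "all_moments M (\<lambda>\<omega>. c)"
proof -
  interpret finite_measure M by fact
  show ?thesis unfolding all_moments_def by simp
qed

lemma all_moments_power:
  assumes "finite_measure M" "all_moments M Y" shows "all_moments M (\<lambda>\<omega>. Y \<omega> ^ k)"
  by (induction k) (auto intro: all_moments_mult all_moments_const assms)

lemma all_moments_sum:
  assumes "finite_measure M" "\<And>i. i \<in> I \<Longrightarrow> all_moments M (Y i)"
  shows "all_moments M (\<lambda>\<omega>. \<Sum>i\<in>I. Y i \<omega>)"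
  using assms(2) by (induction I rule: infinite_finite_induct)
    (auto intro: all_moments_add all_moments_const assms(1))

lemma all_moments_abs: "all_moments M Y \<Longrightarrow> all_moments M (\<lambda>\<omega>. \<bar>Y \<omega>\<bar>)"
  by (auto simp: all_moments_def)

lemma all_moments_diff:
  assumes "all_moments M Y" "all_moments M Z"
  shows "all_moments M (\<lambda>\<omega>. Y \<omega> - Z \<omega>)"
proof -
  have "all_moments M (\<lambda>\<omega>. - Z \<omega>)" using assms(2) by (auto simp: all_moments_def)
  from all_moments_add[OF assms(1) this] show ?thesis by simp
qed

section \<open>Convergence of moments under a common majorant\<close>

lemma integral_power_tendsto:
  assumes Z: "all_moments M Z" and meas: "\<And>k. Y k \<in> borel_measurable M" "Y' \<in> borel_measurable M"
    and le: "\<And>k \<omega>. \<omega> \<in> space M \<Longrightarrow> \<bar>Y k \<omega>\<bar> \<le> Z \<omega>"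
    and lim: "\<And>\<omega>. \<omega> \<in> space M \<Longrightarrow> (\<lambda>k. Y k \<omega>) \<longlonglongrightarrow> Y' \<omega>"
  shows "(\<lambda>k. \<integral>\<omega>. \<bar>Y k \<omega>\<bar> ^ p \<partial>M) \<longlonglongrightarrow> (\<integral>\<omega>. \<bar>Y' \<omega>\<bar> ^ p \<partial>M)"
proof (rule integral_dominated_convergence)
  show "integrable M (\<lambda>\<omega>. \<bar>Z \<omega>\<bar> ^ p)" by (rule all_moments_integrable_power[OF Z])
  show "AE \<omega> in M. (\<lambda>k. \<bar>Y k \<omega>\<bar> ^ p) \<longlonglongrightarrow> \<bar>Y' \<omega>\<bar> ^ p"
    by (intro AE_I2 tendsto_intros lim)
  show "AE \<omega> in M. norm (\<bar>Y k \<omega>\<bar> ^ p) \<le> \<bar>Z \<omega>\<bar> ^ p" for k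
  proof (rule AE_I2)
    fix \<omega> assume "\<omega> \<in> space M"
    then have "\<bar>Y k \<omega>\<bar> \<le> \<bar>Z \<omega>\<bar>" using le[of \<omega> k] by linarith
    then show "norm (\<bar>Y k \<omega>\<bar> ^ p) \<le> \<bar>Z \<omega>\<bar> ^ p" by (simp add: power_mono)
  qed
qed (use meas in auto)

lemma integral_tendsto:
  assumes Z: "all_moments M Z" and meas: "\<And>k. Y k \<in> borel_measurable M" "Y' \<in> borel_measurable M"
    and le: "\<And>k \<omega>. \<omega> \<in> space M \<Longrightarrow> \<bar>Y k \<omega>\<bar> \<le> Z \<omega>"
    and lim: "\<And>\<omega>. \<omega> \<in> space M \<Longrightarrow> (\<lambda>k. Y k \<omega>) \<longlonglongrightarrow> Y' \<omega>"
  shows "(\<lambda>k. \<integral>\<omega>. Y k \<omega> \<partial>M) \<longlonglongrightarrow> (\<integral>\<omega>. Y' \<omega> \<partial>M)"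
  by (rule integral_dominated_convergence[OF _ _ all_moments_integrable[OF Z]])
     (use meas le lim in auto)

text \<open>The means of the \<open>Y k\<close> are bounded by the mean of \<open>Z\<close>, so
  \<open>Z\<close> plus its mean dominates the centred variables. This carries inequalities for
  smooth approximants over to their limits.\<close>

lemma central_moment_tendsto:
  assumes fin: "finite_measure M"
    and Z: "all_moments M Z" and meas: "\<And>k. Y k \<in> borel_measurable M" "Y' \<in> borel_measurable M"
    and le: "\<And>k \<omega>. \<omega> \<in> space M \<Longrightarrow> \<bar>Y k \<omega>\<bar> \<le> Z \<omega>"
    and lim: "\<And>\<omega>. \<omega> \<in> space M \<Longrightarrow> (\<lambda>k. Y k \<omega>) \<longlonglongrightarrow> Y' \<omega>"
  shows "(\<lambda>k. \<integral>\<omega>. \<bar>Y k \<omega> - (\<integral>\<omega>. Y k \<omega> \<partial>M)\<bar> ^ p \<partial>M) \<longlonglongrightarrow>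
         (\<integral>\<omega>. \<bar>Y' \<omega> - (\<integral>\<omega>. Y' \<omega> \<partial>M)\<bar> ^ p \<partial>M)"
proof (rule integral_power_tendsto)
  note [measurable] = meas
  show "all_moments M (\<lambda>\<omega>. Z \<omega> + (\<integral>\<omega>. Z \<omega> \<partial>M))"
    by (intro all_moments_add all_moments_const Z fin)
  fix k
  have "\<bar>\<integral>\<omega>. Y k \<omega> \<partial>M\<bar> \<le> (\<integral>\<omega>. Z \<omega> \<partial>M)"
  proof (rule order_trans[OF integral_abs_bound integral_mono])
    show "integrable M (\<lambda>\<omega>. \<bar>Y k \<omega>\<bar>)"
      by (rule Bochner_Integration.integrable_bound[OF all_moments_integrable[OF Z]])
         (use le in \<open>auto intro!: AE_I2 intro: order_trans[OF _ abs_ge_self]\<close>)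
  qed (use le all_moments_integrable[OF Z] in auto)
  then show "\<bar>Y k \<omega> - (\<integral>\<omega>. Y k \<omega> \<partial>M)\<bar> \<le> Z \<omega> + (\<integral>\<omega>. Z \<omega> \<partial>M)" if "\<omega> \<in> space M" for \<omega>
    using le[OF that, of k] by linarith
  show "(\<lambda>\<omega>. Y k \<omega> - (\<integral>\<omega>. Y k \<omega> \<partial>M)) \<in> borel_measurable M" by measurable
  show "(\<lambda>\<omega>. Y' \<omega> - (\<integral>\<omega>. Y' \<omega> \<partial>M)) \<in> borel_measurable M" by measurable
  show "(\<lambda>k. Y k \<omega> - (\<integral>\<omega>. Y k \<omega> \<partial>M)) \<longlonglongrightarrow> Y' \<omega> - (\<integral>\<omega>. Y' \<omega> \<partial>M)" if "\<omega> \<in> space M" for \<omega>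
    by (intro tendsto_diff lim that integral_tendsto[OF Z] meas le)
qed

lemma Lp_norm_eq:
  assumes "integrable M (\<lambda>\<omega>. \<bar>Y \<omega>\<bar> ^ p)" "p \<noteq> 0"
  shows "Lp_norm M (real p) Y = ennreal ((\<integral>\<omega>. \<bar>Y \<omega>\<bar> ^ p \<partial>M) powr (1 / real p))"
proof -
  have "(\<integral>\<^sup>+ \<omega>. ennreal (\<bar>Y \<omega>\<bar> powr real p) \<partial>M) = (\<integral>\<^sup>+ \<omega>. ennreal (\<bar>Y \<omega>\<bar> ^ p) \<partial>M)"
    using assms(2) by (simp add: powr_realpow')
  also have "\<dots> = ennreal (\<integral>\<omega>. \<bar>Y \<omega>\<bar> ^ p \<partial>M)"
    by (rule nn_integral_eq_integral[OF assms(1)]) simp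
  finally show ?thesis by (simp add: Lp_norm_def)
qed

section \<open>Gradients of sums of functions of one coordinate\<close>

lemma partial_deriv_sum:
  assumes "\<And>s. (F has_real_derivative F' s) (at s)" "finite I"
  shows "partial_deriv j (\<lambda>x. \<Sum>i\<in>I. F (x i)) x = (if j \<in> I then F' (x j) else 0)"
proof -
  have "((\<lambda>s. F ((x(j := s)) i)) has_real_derivative (if i = j then F' (x j) else 0)) (at (x j))" for i
    using assms(1) by (cases "i = j") auto
  then have "((\<lambda>s. \<Sum>i\<in>I. F ((x(j := s)) i)) has_real_derivative
      (\<Sum>i\<in>I. if i = j then F' (x j) else 0)) (at (x j))"
    by (intro DERIV_sum)
  then show ?thesis
    unfolding partial_deriv_def using assms(2) by (simp add: DERIV_imp_deriv)
qed

lemma grad_norm_sum: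
  assumes "\<And>s. (F has_real_derivative F' s) (at s)" "I \<subseteq> {..<n}"
  shows "grad_norm n (\<lambda>x. \<Sum>i\<in>I. F (x i)) x = sqrt (\<Sum>i\<in>I. (F' (x i))\<^sup>2)"
proof -
  have "finite I" using assms(2) finite_subset by blast
  then have "(\<Sum>i<n. (partial_deriv i (\<lambda>x. \<Sum>i\<in>I. F (x i)) x)\<^sup>2) = (\<Sum>i<n. if i \<in> I then (F' (x i))\<^sup>2 else 0)"
    by (intro sum.cong) (simp_all add: partial_deriv_sum[OF assms(1)])
  also have "\<dots> = (\<Sum>i\<in>I. (F' (x i))\<^sup>2)"
    using assms(2) by (simp add: sum.If_cases Int_absorb1)
  finally show ?thesis by (simp add: grad_norm_def)
qed

lemma abs_arctan_le: "\<bar>arctan x\<bar> \<le> \<bar>x\<bar>" for x :: real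
proof -
  have "norm (arctan x - arctan 0) \<le> 1 * norm (x - 0)"
    by (rule field_differentiable_bound[where S = UNIV and f' = "\<lambda>x. inverse (1 + x\<^sup>2)"])
       (use DERIV_arctan in \<open>auto simp: abs_le_iff inverse_le_1_iff add_pos_nonneg simp del: DERIV_arctan\<close>)
  then show ?thesis by simp
qed

lemma measurable_random_point:
  assumes "\<And>i. i < n \<Longrightarrow> X i \<in> borel_measurable M"
  shows "random_point n X \<in> borel_measurable M"
proof (rule measurable_coordinatewise_then_product)
  show "(\<lambda>\<omega>. random_point n X \<omega> i) \<in> borel_measurable M" for i
    using assms by (cases "i < n") (simp_all add: random_point_def)
qed

section \<open>Integrability of the coordinates\<close>

locale gradient_moments = prob_space M for M :: "'a measure" +
  fixes n :: nat and X :: "nat \<Rightarrow> 'a \<Rightarrow> real" and L :: real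
  assumes measurable_X [measurable]: "\<And>i. i < n \<Longrightarrow> X i \<in> borel_measurable M"
    and L_pos: "L > 0"
    and ineq: "moment_gradient_inequality M n X L"
begin

lemma finite_measure_M: "finite_measure M" by unfold_locales

lemmas measurable_random_point_X [measurable] = measurable_random_point[OF measurable_X]

text \<open>The hypothesis with both sides raised to the power \<open>p\<close>, which replaces
  extended norms by real integrals without roots. Existence of all moments makes both norms
  finite.\<close>

lemma moment_inequality:
  assumes g: "smooth_term g"
    and Y: "all_moments M (\<lambda>\<omega>. g (random_point n X \<omega>))"
    and G: "all_moments M (\<lambda>\<omega>. grad_norm n g (random_point n X \<omega>))" and p: "2 \<le> p"
  shows "(\<integral>\<omega>. \<bar>g (random_point n X \<omega>) - (\<integral>\<omega>. g (random_point n X \<omega>) \<partial>M)\<bar> ^ p \<partial>M)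
    \<le> (L * sqrt (real p)) ^ p * (\<integral>\<omega>. \<bar>grad_norm n g (random_point n X \<omega>)\<bar> ^ p \<partial>M)"
    (is "?A \<le> ?c ^ p * ?B")
proof -
  have iY: "integrable M (\<lambda>\<omega>. \<bar>g (random_point n X \<omega>) - (\<integral>\<omega>. g (random_point n X \<omega>) \<partial>M)\<bar> ^ p)"
    by (intro all_moments_integrable_power all_moments_diff Y all_moments_const finite_measure_M)
  have iG: "integrable M (\<lambda>\<omega>. \<bar>grad_norm n g (random_point n X \<omega>)\<bar> ^ p)"
    by (intro all_moments_integrable_power G)
  have "Lp_norm M (real p) (\<lambda>\<omega>. g (random_point n X \<omega>) - (\<integral>\<omega>. g (random_point n X \<omega>) \<partial>M))
      \<le> ennreal ?c * Lp_norm M (real p) (\<lambda>\<omega>. grad_norm n g (random_point n X \<omega>))"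
    using ineq p all_moments_integrable[OF Y] smooth_term_imp_smooth[OF g]
    unfolding moment_gradient_inequality_def by simp
  then have "ennreal (?A powr (1 / p)) \<le> ennreal ?c * ennreal (?B powr (1 / p))"
    using p by (simp add: Lp_norm_eq[OF iY] Lp_norm_eq[OF iG])
  then have *: "?A powr (1 / p) \<le> ?c * ?B powr (1 / p)"
    using L_pos by (simp add: ennreal_mult'[symmetric])
  have pw: "(a powr (1 / p)) ^ p = a" if "a \<ge> 0" for a :: real
    using that p by (simp add: powr_realpow'[symmetric] powr_powr)
  have "?A \<ge> 0" "?B \<ge> 0" by simp_all
  then have "?A = (?A powr (1 / p)) ^ p" by (simp add: pw)
  also have "\<dots> \<le> (?c * ?B powr (1 / p)) ^ p"
    by (intro power_mono *) simp
  also have "\<dots> = ?c ^ p * ?B" using \<open>?B \<ge> 0\<close> by (simp add: power_mult_distrib pw)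
  finally show ?thesis .
qed

text \<open>The hypothesis applies to integrable \<open>g(X)\<close> only, so it is used for the truncations
  \<open>k arctan (x / k)\<close>: their variances are uniformly bounded, and their means are bounded because
  \<open>X i\<close> lies in a fixed interval with probability above \<open>1/2\<close>.\<close>

lemma square_integrable_X:
  assumes i: "i < n" shows "integrable M (\<lambda>\<omega>. (X i \<omega>)\<^sup>2)"
proof -
  note [measurable] = measurable_X[OF i]
  \<comment> \<open>Each truncation is bounded, its derivative lies between 0 and 1, and the
    truncations converge pointwise to the identity.\<close>
  define \<phi> where "\<phi> j x = real (Suc j) * arctan (x / real (Suc j))" for j x
  define \<phi>' where "\<phi>' j x = 1 / (1 + (x / real (Suc j))\<^sup>2)" for j x
  have pos: "1 + x\<^sup>2 > 0" for x :: real by (smt (verit) zero_le_power2)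
  have \<phi>: "(\<phi> j has_real_derivative \<phi>' j x) (at x)" for j x
  proof -
    have "((\<lambda>x. real (Suc j) * arctan (x / real (Suc j))) has_real_derivative
        real (Suc j) * (inverse (1 + (x / real (Suc j))\<^sup>2) * (1 / real (Suc j)))) (at x)"
      by (rule derivative_eq_intros | simp)+
    then show ?thesis by (simp add: \<phi>_def[abs_def] \<phi>'_def inverse_eq_divide)
  qed
  have \<phi>'_bound: "0 \<le> \<phi>' j x" "\<phi>' j x \<le> 1" for j x
    using pos[of "x / real (Suc j)"] by (auto simp: \<phi>'_def)
  have "\<phi>' j = (\<lambda>x. poly 1 x / poly [:1, 0, 1 / (real (Suc j))\<^sup>2:] x ^ 1)" for j
    by (auto simp: \<phi>'_def power2_eq_square)
  moreover have "poly [:1, 0, 1 / (real (Suc j))\<^sup>2:] x \<noteq> 0" for j x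
    using pos[of "x / real (Suc j)"] by (simp add: power2_eq_square)
  ultimately have "smooth_on_line (\<phi>' j)" for j
    using smooth_on_line_quotient[of "[:1, 0, 1 / (real (Suc j))\<^sup>2:]" 1 1] by presburger
  then have smooth: "smooth_term (\<lambda>x. \<phi> j (x i))" for j
    by (intro smooth_term.coord smooth_on_lineI[OF \<phi>])
  have rp: "random_point n X \<omega> i = X i \<omega>" for \<omega> using i by (simp add: random_point_def)
  have meas [measurable]: "\<phi> j \<in> borel_measurable borel" for j
    unfolding \<phi>_def by measurable
  have mom: "all_moments M (\<lambda>\<omega>. \<phi> j (X i \<omega>))" for j
  proof (rule all_moments_dominated[OF all_moments_const[OF finite_measure_M, of "real (Suc j) * (pi / 2)"]])
    fix \<omega>
    have "\<bar>arctan (X i \<omega> / real (Suc j))\<bar> \<le> pi / 2"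
      using arctan_bounded[of "X i \<omega> / real (Suc j)"] by linarith
    then show "\<bar>\<phi> j (X i \<omega>)\<bar> \<le> \<bar>real (Suc j) * (pi / 2)\<bar>"
      by (simp only: \<phi>_def abs_mult) (intro mult_mono, auto)
  qed simp
  have grad: "grad_norm n (\<lambda>x. \<phi> j (x i)) x = \<phi>' j (x i)" for j x
    using grad_norm_sum[OF \<phi>, of "{i}" n j x] i \<phi>'_bound(1) by simp
  \<comment> \<open>Exponent 2 in the hypothesis gives the constant
    \<open>(L * sqrt 2)\<^sup>2\<close>, uniformly in \<open>j\<close>.\<close>
  have var: "variance (\<lambda>\<omega>. \<phi> j (X i \<omega>)) \<le> 2 * L\<^sup>2" for j
  proof -
    have g: "all_moments M (\<lambda>\<omega>. \<phi>' j (X i \<omega>))"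
      by (rule all_moments_dominated[OF all_moments_const[OF finite_measure_M, of 1]])
         (use \<phi>'_bound in \<open>auto simp: \<phi>'_def\<close>)
    have "(\<integral>\<omega>. \<bar>\<phi>' j (X i \<omega>)\<bar>\<^sup>2 \<partial>M) \<le> (\<integral>\<omega>. 1 \<partial>M)"
      by (intro integral_mono all_moments_integrable_power g)
         (use \<phi>'_bound in \<open>auto simp: abs_square_le_1\<close>)
    moreover have "variance (\<lambda>\<omega>. \<phi> j (X i \<omega>)) \<le> (L * sqrt 2)\<^sup>2 * (\<integral>\<omega>. \<bar>\<phi>' j (X i \<omega>)\<bar>\<^sup>2 \<partial>M)"
      using moment_inequality[OF smooth, of j 2] mom g by (simp add: rp grad)
    moreover have "(L * sqrt 2)\<^sup>2 * (\<integral>\<omega>. \<bar>\<phi>' j (X i \<omega>)\<bar>\<^sup>2 \<partial>M) \<le> (L * sqrt 2)\<^sup>2 * 1"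
      using calculation(1) by (intro mult_left_mono) (simp_all add: prob_space)
    ultimately show ?thesis by (simp add: power_mult_distrib)
  qed
  have "(\<lambda>R::nat. prob {\<omega> \<in> space M. \<bar>X i \<omega>\<bar> \<le> real R}) \<longlonglongrightarrow>
      prob (\<Union>R::nat. {\<omega> \<in> space M. \<bar>X i \<omega>\<bar> \<le> real R})"
    by (intro finite_Lim_measure_incseq) (auto simp: incseq_def)
  moreover have "(\<Union>R::nat. {\<omega> \<in> space M. \<bar>X i \<omega>\<bar> \<le> real R}) = space M"
    using real_arch_simple by auto
  ultimately have "(\<lambda>R::nat. prob {\<omega> \<in> space M. \<bar>X i \<omega>\<bar> \<le> real R}) \<longlonglongrightarrow> 1"
    by (simp add: prob_space)
  then have "eventually (\<lambda>R::nat. prob {\<omega> \<in> space M. \<bar>X i \<omega>\<bar> \<le> real R} > 1 / 2) sequentially"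
    by (rule order_tendstoD) simp
  then obtain R :: nat where R: "prob {\<omega> \<in> space M. \<bar>X i \<omega>\<bar> \<le> real R} > 1 / 2"
    by (auto simp: eventually_sequentially)
  \<comment> \<open>Chebyshev at distance \<open>2 * L\<close> leaves an exceptional set of
    probability at most 1/2, which cannot contain the event \<open>\<bar>X i\<bar> \<le> R\<close>.
    A point of that event outside the exceptional set locates the mean, because
    \<open>\<bar>\<phi> j x\<bar> \<le> \<bar>x\<bar>\<close>.\<close>
  have mean: "\<bar>expectation (\<lambda>\<omega>. \<phi> j (X i \<omega>))\<bar> \<le> real R + 2 * L" for j
  proof -
    let ?\<mu> = "expectation (\<lambda>\<omega>. \<phi> j (X i \<omega>))"
    let ?A = "{\<omega> \<in> space M. \<bar>X i \<omega>\<bar> \<le> real R}"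
    let ?B = "{\<omega> \<in> space M. 2 * L \<le> \<bar>\<phi> j (X i \<omega>) - ?\<mu>\<bar>}"
    have "prob ?B \<le> variance (\<lambda>\<omega>. \<phi> j (X i \<omega>)) / (2 * L)\<^sup>2"
      by (rule Chebyshev_inequality)
         (use L_pos all_moments_integrable_power[OF mom, of j 2] in auto)
    also have "\<dots> \<le> 2 * L\<^sup>2 / (2 * L)\<^sup>2" by (intro divide_right_mono var) simp
    also have "\<dots> = 1 / 2" using L_pos by (simp add: power_mult_distrib)
    finally have "prob ?B < prob ?A" using R by simp
    then have "\<not> ?A \<subseteq> ?B"
      using finite_measure_mono[of ?A ?B] by force
    then obtain \<omega> where \<omega>: "\<bar>X i \<omega>\<bar> \<le> real R" "\<bar>\<phi> j (X i \<omega>) - ?\<mu>\<bar> < 2 * L" by force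
    have "\<bar>\<phi> j (X i \<omega>)\<bar> = real (Suc j) * \<bar>arctan (X i \<omega> / real (Suc j))\<bar>"
      by (simp add: \<phi>_def abs_mult)
    also have "\<dots> \<le> real (Suc j) * \<bar>X i \<omega> / real (Suc j)\<bar>"
      by (intro mult_left_mono abs_arctan_le) simp
    also have "\<dots> = \<bar>X i \<omega>\<bar>" by (simp add: abs_divide)
    finally show ?thesis using \<omega> by linarith
  qed
  define K where "K = 2 * L\<^sup>2 + (real R + 2 * L)\<^sup>2"
  have sq: "(\<integral>\<^sup>+\<omega>. ennreal ((\<phi> j (X i \<omega>))\<^sup>2) \<partial>M) \<le> ennreal K" for j
  proof -
    have i2: "integrable M (\<lambda>\<omega>. (\<phi> j (X i \<omega>))\<^sup>2)"
      using all_moments_integrable_power[OF mom, of j 2] by simp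
    have "(expectation (\<lambda>\<omega>. \<phi> j (X i \<omega>)))\<^sup>2 \<le> (real R + 2 * L)\<^sup>2"
      using mean[of j] by (intro iffD1[OF abs_le_square_iff]) linarith
    then have "expectation (\<lambda>\<omega>. (\<phi> j (X i \<omega>))\<^sup>2) \<le> K"
      using var[of j] variance_eq[OF all_moments_integrable[OF mom] i2] by (simp add: K_def)
    then show ?thesis using nn_integral_eq_integral[OF i2] by (simp add: ennreal_leI)
  qed
  have lim: "(\<lambda>j. \<phi> j x) \<longlonglongrightarrow> x" for x
  proof -
    have "((\<lambda>s. arctan (x * s)) has_real_derivative x) (at 0)"
      by (auto intro!: derivative_eq_intros)
    then have "(\<lambda>h. (arctan (x * (0 + h)) - arctan (x * 0)) / h) \<midarrow>0\<rightarrow> x"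
      unfolding DERIV_def .
    moreover have "filterlim (\<lambda>j. inverse (real (Suc j))) (at 0) sequentially"
      using LIMSEQ_inverse_real_of_nat by (auto simp: filterlim_at)
    ultimately have "(\<lambda>j. (arctan (x * (0 + inverse (real (Suc j)))) - arctan (x * 0)) / inverse (real (Suc j))) \<longlonglongrightarrow> x"
      by (rule filterlim_compose)
    then show ?thesis by (simp only: \<phi>_def) (simp add: divide_inverse mult.commute)
  qed
  \<comment> \<open>Fatou's lemma transfers the uniform second moment bound from the truncations to
    \<open>X i\<close>.\<close>
  have "(\<integral>\<^sup>+\<omega>. ennreal ((X i \<omega>)\<^sup>2) \<partial>M) = (\<integral>\<^sup>+\<omega>. liminf (\<lambda>j. ennreal ((\<phi> j (X i \<omega>))\<^sup>2)) \<partial>M)"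
    by (intro nn_integral_cong lim_imp_Liminf[symmetric] tendsto_ennrealI tendsto_power lim trivial_limit_sequentially)
  also have "\<dots> \<le> liminf (\<lambda>j. \<integral>\<^sup>+\<omega>. ennreal ((\<phi> j (X i \<omega>))\<^sup>2) \<partial>M)"
    by (rule nn_integral_liminf) simp
  also have "\<dots> \<le> ennreal K"
    using sq by (intro Liminf_le always_eventually allI) simp_all
  finally have "(\<integral>\<^sup>+\<omega>. ennreal ((X i \<omega>)\<^sup>2) \<partial>M) < \<infinity>"
    by (rule le_less_trans) simp
  moreover have "(\<lambda>\<omega>. (X i \<omega>)\<^sup>2) \<in> borel_measurable M" by simp
  ultimately show ?thesis by (simp add: integrable_iff_bounded)
qed

text \<open>Once \<open>X i\<close> is known to be integrable, the hypothesis applies to the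
  coordinate function itself. Its gradient has norm 1, so every central moment of integer order at
  least 2 is finite.\<close>

lemma all_moments_X:
  assumes i: "i < n" shows "all_moments M (X i)"
proof -
  note [measurable] = measurable_X[OF i]
  have intX: "integrable M (X i)"
    by (rule square_integrable_imp_integrable[OF measurable_X[OF i] square_integrable_X[OF i]])
  have rp: "random_point n X \<omega> i = X i \<omega>" for \<omega> using i by (simp add: random_point_def)
  have id: "((\<lambda>x. x) has_real_derivative 1) (at x)" for x :: real by simp
  have grad: "grad_norm n (\<lambda>x. x i) x = 1" for x
    using grad_norm_sum[OF id, of "{i}" n x] i by simp
  have "poly [:0, 1:] = (\<lambda>x :: real. x)" by (rule ext) simp
  then have "smooth_on_line (\<lambda>x. x)" using smooth_on_line_poly[of "[:0, 1:]"] by simp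
  then have smooth: "smooth n (\<lambda>x. x i)"
    by (intro smooth_term_imp_smooth smooth_term.coord)
  have fin: "integrable M (\<lambda>\<omega>. \<bar>X i \<omega> - expectation (X i)\<bar> ^ p)" if p: "2 \<le> p" for p
  proof -
    let ?m = "\<integral>\<^sup>+\<omega>. ennreal (\<bar>X i \<omega> - expectation (X i)\<bar> powr real p) \<partial>M"
    have "Lp_norm M (real p) (\<lambda>\<omega>. X i \<omega> - expectation (X i)) \<le> ennreal (L * sqrt p) * Lp_norm M (real p) (\<lambda>\<omega>. 1)"
      using ineq[unfolded moment_gradient_inequality_def, rule_format, of "real p", OF _ smooth] p intX
      by (simp add: rp grad)
    also have "\<dots> < \<infinity>"
      using Lp_norm_eq[of M "\<lambda>\<omega>. 1" p] p by (simp add: ennreal_mult_less_top)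
    \<comment> \<open>An infinite moment would make \<open>Lp_norm\<close> infinite by its
      definition.\<close>
    finally have "?m \<noteq> \<infinity>" by (auto simp: Lp_norm_def Let_def split: if_splits)
    then have "(\<integral>\<^sup>+\<omega>. ennreal (\<bar>X i \<omega> - expectation (X i)\<bar> ^ p) \<partial>M) < \<infinity>"
      using p by (simp add: powr_realpow' less_top)
    then show ?thesis by (intro integrableI_bounded) auto
  qed
  have "all_moments M (\<lambda>\<omega>. X i \<omega> - expectation (X i))"
    unfolding all_moments_def
  proof (intro conjI allI)
    fix k :: nat
    show "integrable M (\<lambda>\<omega>. \<bar>X i \<omega> - expectation (X i)\<bar> ^ k)"
    proof (cases "2 \<le> k")
      case False
      then have "k = 0 \<or> k = 1" by auto
      then show ?thesis using intX by auto
    qed (rule fin)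
  qed simp
  from all_moments_add[OF this all_moments_const[OF finite_measure_M, of "expectation (X i)"]]
  show ?thesis by simp
qed

end

section \<open>The moment inequality for sums and Euclidean norms\<close>

text \<open>The \<open>k\<close>-th approximation has error \<open>1 / (k + 1)\<close> times a fixed
  weight. The bound \<open>A * (1 + x\<^sup>2) ^ K\<close>, independent of \<open>k\<close>,
  provides the majorant for dominated convergence.\<close>

lemma smooth_approximating_sequence:
  fixes f f' :: "real \<Rightarrow> real"
  assumes f: "\<And>x. (f has_real_derivative f' x) (at x)" and cont: "continuous_on UNIV f'"
    and growth: "\<And>x. \<bar>f' x\<bar> \<le> B * (1 + x\<^sup>2) ^ m"
  obtains F F' A K where "\<And>k. smooth_on_line (F k)" "\<And>k x. (F k has_real_derivative F' k x) (at x)"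
    "\<And>k x. \<bar>F k x\<bar> \<le> A * (1 + x\<^sup>2) ^ K" "\<And>k x. \<bar>F' k x\<bar> \<le> A * (1 + x\<^sup>2) ^ K"
    "\<And>x. (\<lambda>k. F k x) \<longlonglongrightarrow> f x" "\<And>x. (\<lambda>k. F' k x) \<longlonglongrightarrow> f' x"
    "\<And>k. continuous_on UNIV (F' k)"
proof -
  have "\<exists>F F'. smooth_on_line F \<and> smooth_on_line F' \<and> (\<forall>x. (F has_real_derivative F' x) (at x)) \<and>
      (\<forall>x. \<bar>F x - f x\<bar> \<le> inverse (real (Suc k)) * (1 + x\<^sup>2) ^ (m + 2)) \<and>
      (\<forall>x. \<bar>F' x - f' x\<bar> \<le> inverse (real (Suc k)) * (1 + x\<^sup>2) ^ (m + 2))" for k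
    by (rule smooth_approximation[OF f cont growth, of "inverse (real (Suc k))"]) (simp, blast)
  then obtain F F' where F: "\<And>k. smooth_on_line (F k)" "\<And>k. smooth_on_line (F' k)"
    "\<And>k x. (F k has_real_derivative F' k x) (at x)"
    "\<And>k x. \<bar>F k x - f x\<bar> \<le> inverse (real (Suc k)) * (1 + x\<^sup>2) ^ (m + 2)"
    "\<And>k x. \<bar>F' k x - f' x\<bar> \<le> inverse (real (Suc k)) * (1 + x\<^sup>2) ^ (m + 2)"
    by metis
  obtain A1 k1 where A1: "\<And>x. \<bar>f x\<bar> \<le> A1 * (1 + x\<^sup>2) ^ k1"
    using polynomial_growth_antiderivative[OF f growth] by blast
  define A K where "A = A1 + B + 1" and "K = k1 + m + 2"
  have nn: "0 \<le> A1" "0 \<le> B" using A1[of 0] growth[of 0] by simp_all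
  have weight: "inverse (real (Suc k)) * (1 + x\<^sup>2) ^ (m + 2) \<le> 1 * (1 + x\<^sup>2) ^ K" for x :: real and k
    by (intro mult_mono power_increasing) (auto simp: K_def inverse_le_1_iff)
  have b1: "\<bar>F k x\<bar> \<le> A * (1 + x\<^sup>2) ^ K" for k x
  proof -
    have "A1 * (1 + x\<^sup>2) ^ k1 \<le> A1 * (1 + x\<^sup>2) ^ K"
      using nn by (intro mult_left_mono power_increasing) (auto simp: K_def)
    moreover have "0 \<le> B * (1 + x\<^sup>2) ^ K" using nn by simp
    ultimately show ?thesis
      using F(4)[of k x] weight[of k x] A1[of x] by (simp add: A_def distrib_right)
  qed
  have b2: "\<bar>F' k x\<bar> \<le> A * (1 + x\<^sup>2) ^ K" for k x
  proof -
    have "B * (1 + x\<^sup>2) ^ m \<le> B * (1 + x\<^sup>2) ^ K"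
      using nn by (intro mult_left_mono power_increasing) (auto simp: K_def)
    moreover have "0 \<le> A1 * (1 + x\<^sup>2) ^ K" using nn by simp
    ultimately show ?thesis
      using F(5)[of k x] weight[of k x] growth[of x] by (simp add: A_def distrib_right)
  qed
  have lim: "(\<lambda>k. inverse (real (Suc k)) * (1 + x\<^sup>2) ^ (m + 2)) \<longlonglongrightarrow> 0" for x
    by (rule tendsto_mult_left_zero[OF LIMSEQ_inverse_real_of_nat])
  have l1: "(\<lambda>k. F k x) \<longlonglongrightarrow> f x" for x
    using F(4) by (intro LIM_zero_cancel[OF Lim_null_comparison[OF _ lim[of x]]] always_eventually) simp
  have l2: "(\<lambda>k. F' k x) \<longlonglongrightarrow> f' x" for x
    using F(5) by (intro LIM_zero_cancel[OF Lim_null_comparison[OF _ lim[of x]]] always_eventually) simp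
  have c: "continuous_on UNIV (F' k)" for k
    by (rule smooth_on_lineE[OF F(2)[of k]]) (rule continuous_on_UNIV_if_DERIV)
  show thesis by (rule that[OF F(1) F(3) b1 b2 l1 l2 c])
qed

text \<open>With \<open>S = e + (\<Sum>i<n. (F (x i))\<^sup>2)\<close> the partial derivatives are
  \<open>F (x i) * F' (x i) / sqrt S\<close>, so the squared gradient combines the
  \<open>(F' (x i))\<^sup>2\<close> with weights of total at most 1 and is bounded by the largest of
  them. The sum of \<open>p\<close>-th powers replaces this maximum because its expectation splits
  over the coordinates.\<close>

lemma grad_norm_sqrt_sum:
  assumes F: "\<And>s. (F has_real_derivative F' s) (at s)" and e: "e > 0" and p: "p > 0"
  shows "(grad_norm n (\<lambda>x. (e + (\<Sum>i<n. F (x i) * F (x i))) powr (1 / 2)) x) ^ p \<le> (\<Sum>i<n. \<bar>F' (x i)\<bar> ^ p)"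
proof (cases "n = 0")
  case True then show ?thesis using p by (simp add: grad_norm_def zero_power)
next
  case False
  define S where "S = e + (\<Sum>i<n. F (x i) * F (x i))"
  have S: "S > 0" "(\<Sum>i<n. (F (x i))\<^sup>2) \<le> S"
    using e by (auto simp: S_def power2_eq_square intro!: add_pos_nonneg sum_nonneg)
  have pd: "partial_deriv i (\<lambda>x. (e + (\<Sum>i<n. F (x i) * F (x i))) powr (1 / 2)) x =
      F (x i) * F' (x i) / sqrt S" if i: "i < n" for i
  proof -
    have "((\<lambda>s. F s * F s) has_real_derivative 2 * F s * F' s) (at s)" for s
      by (auto intro!: derivative_eq_intros F)
    then have "((\<lambda>s. F ((x(i := s)) j) * F ((x(i := s)) j)) has_real_derivative
        (if j = i then 2 * F (x i) * F' (x i) else 0)) (at (x i))" for j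
      by (cases "i = j") auto
    then have "((\<lambda>s. \<Sum>j<n. F ((x(i := s)) j) * F ((x(i := s)) j)) has_real_derivative
        (\<Sum>j<n. if j = i then 2 * F (x i) * F' (x i) else 0)) (at (x i))"
      by (intro DERIV_sum)
    then have "((\<lambda>s. e + (\<Sum>j<n. F ((x(i := s)) j) * F ((x(i := s)) j))) has_real_derivative
        0 + 2 * F (x i) * F' (x i)) (at (x i))"
      using i by (intro DERIV_add DERIV_const) simp
    from DERIV_fun_powr[OF this, of "1 / 2"] S(1)
    have "((\<lambda>s. (e + (\<Sum>j<n. F ((x(i := s)) j) * F ((x(i := s)) j))) powr (1 / 2)) has_real_derivative
        1 / 2 * S powr (1 / 2 - 1) * (2 * F (x i) * F' (x i))) (at (x i))"
      by (simp add: S_def)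
    moreover have "S powr (1 / 2 - 1) = 1 / sqrt S"
      using S(1) by (simp only: powr_diff powr_half_sqrt) (simp add: real_sqrt_divide[symmetric] divide_simps)
    ultimately show ?thesis
      unfolding partial_deriv_def by (simp add: DERIV_imp_deriv)
  qed
  obtain j where j: "j < n" "\<And>i. i < n \<Longrightarrow> \<bar>F' (x i)\<bar> \<le> \<bar>F' (x j)\<bar>"
  proof -
    let ?V = "(\<lambda>i. \<bar>F' (x i)\<bar>) ` {..<n}"
    have "finite ?V" "?V \<noteq> {}" using False by auto
    then have "Max ?V \<in> ?V" by (rule Max_in)
    then obtain j where "j < n" "Max ?V = \<bar>F' (x j)\<bar>" by auto
    moreover have "\<bar>F' (x i)\<bar> \<le> Max ?V" if "i < n" for i
      using \<open>finite ?V\<close> that by (intro Max_ge) auto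
    ultimately show thesis using that by presburger
  qed
  have "(\<Sum>i<n. (partial_deriv i (\<lambda>x. (e + (\<Sum>i<n. F (x i) * F (x i))) powr (1 / 2)) x)\<^sup>2) =
      (\<Sum>i<n. (F (x i))\<^sup>2 * (F' (x i))\<^sup>2 / S)"
    using S by (intro sum.cong refl) (simp add: pd power_mult_distrib power_divide)
  also have "\<dots> \<le> (\<Sum>i<n. (F (x i))\<^sup>2 * (F' (x j))\<^sup>2 / S)"
    using S j by (intro sum_mono divide_right_mono mult_left_mono) (auto simp: abs_le_square_iff[symmetric])
  also have "\<dots> = (F' (x j))\<^sup>2 * ((\<Sum>i<n. (F (x i))\<^sup>2) / S)"
    by (simp add: sum_distrib_left sum_divide_distrib mult.commute)
  also have "\<dots> \<le> (F' (x j))\<^sup>2 * 1"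
    using S by (intro mult_left_mono) auto
  finally have "grad_norm n (\<lambda>x. (e + (\<Sum>i<n. F (x i) * F (x i))) powr (1 / 2)) x \<le> \<bar>F' (x j)\<bar>"
    unfolding grad_norm_def by (simp add: real_le_lsqrt)
  then have "(grad_norm n (\<lambda>x. (e + (\<Sum>i<n. F (x i) * F (x i))) powr (1 / 2)) x) ^ p \<le> \<bar>F' (x j)\<bar> ^ p"
    by (intro power_mono) (auto simp: grad_norm_def sum_nonneg)
  also have "\<dots> \<le> (\<Sum>i<n. \<bar>F' (x i)\<bar> ^ p)"
    by (rule member_le_sum[of j "{..<n}" "\<lambda>i. \<bar>F' (x i)\<bar> ^ p"]) (simp_all add: j(1))
  finally show ?thesis .
qed

lemma (in prob_space) raw_moment_le:
  assumes "all_moments M Y"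
  shows "expectation (\<lambda>\<omega>. \<bar>Y \<omega>\<bar> ^ p) \<le>
    2 ^ p * (\<bar>expectation Y\<bar> ^ p + expectation (\<lambda>\<omega>. \<bar>Y \<omega> - expectation Y\<bar> ^ p))"
proof -
  have fin: "finite_measure M" by unfold_locales
  have i: "integrable M (\<lambda>\<omega>. \<bar>Y \<omega> - expectation Y\<bar> ^ p)"
    by (intro all_moments_integrable_power all_moments_diff assms all_moments_const fin)
  have "expectation (\<lambda>\<omega>. \<bar>Y \<omega>\<bar> ^ p) \<le>
      expectation (\<lambda>\<omega>. 2 ^ p * (\<bar>expectation Y\<bar> ^ p + \<bar>Y \<omega> - expectation Y\<bar> ^ p))"
  proof (rule integral_mono)
    show "\<bar>Y \<omega>\<bar> ^ p \<le> 2 ^ p * (\<bar>expectation Y\<bar> ^ p + \<bar>Y \<omega> - expectation Y\<bar> ^ p)" for \<omega>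
      using abs_add_power_le[of "expectation Y" "Y \<omega> - expectation Y" p] by simp
  qed (use i assms in \<open>auto intro!: all_moments_integrable_power\<close>)
  also have "\<dots> = 2 ^ p * (\<bar>expectation Y\<bar> ^ p + expectation (\<lambda>\<omega>. \<bar>Y \<omega> - expectation Y\<bar> ^ p))"
    using i by (simp add: prob_space)
  finally show ?thesis .
qed

section \<open>The hypothesis for functions of polynomial growth\<close>

context gradient_moments begin

lemma all_moments_weight: "i < n \<Longrightarrow> all_moments M (\<lambda>\<omega>. A * (1 + (X i \<omega>)\<^sup>2) ^ K)"
  by (intro all_moments_mult all_moments_const finite_measure_M all_moments_power all_moments_add all_moments_X)

lemma all_moments_growth:
  assumes "i < n" "continuous_on UNIV f" "\<And>x. \<bar>f x\<bar> \<le> A * (1 + x\<^sup>2) ^ K"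
  shows "all_moments M (\<lambda>\<omega>. f (X i \<omega>))"
proof (rule all_moments_dominated[OF all_moments_weight[OF assms(1), of A K]])
  show "(\<lambda>\<omega>. f (X i \<omega>)) \<in> borel_measurable M"
    by (rule measurable_compose[OF measurable_X[OF assms(1)] borel_measurable_continuous_onI[OF assms(2)]])
qed (use assms(3) in \<open>auto intro: order_trans[OF _ abs_ge_self]\<close>)

lemma all_moments_sqrt_sum_squares:
  assumes "\<And>i. i \<in> I \<Longrightarrow> all_moments M (Y i)"
  shows "all_moments M (\<lambda>\<omega>. sqrt (\<Sum>i\<in>I. (Y i \<omega>)\<^sup>2))"
proof (rule all_moments_dominated)
  show "all_moments M (\<lambda>\<omega>. \<Sum>i\<in>I. \<bar>Y i \<omega>\<bar>)"
    by (intro all_moments_sum all_moments_abs finite_measure_M assms)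
  show "\<bar>sqrt (\<Sum>i\<in>I. (Y i \<omega>)\<^sup>2)\<bar> \<le> \<bar>\<Sum>i\<in>I. \<bar>Y i \<omega>\<bar>\<bar>" for \<omega>
    using L2_set_le_sum_abs[of "\<lambda>i. Y i \<omega>" I] by (simp add: L2_set_def sum_nonneg)
  show "(\<lambda>\<omega>. sqrt (\<Sum>i\<in>I. (Y i \<omega>)\<^sup>2)) \<in> borel_measurable M"
    using assms[THEN all_moments_measurable] by (intro measurable_compose[OF _ borel_measurable_sqrt] borel_measurable_sum borel_measurable_power)
qed

lemma measurable_grad_norm:
  assumes "smooth_term g"
  shows "(\<lambda>\<omega>. grad_norm n g (random_point n X \<omega>)) \<in> borel_measurable M"
proof -
  have [measurable]: "partial_deriv i g \<in> borel_measurable borel" for i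
    by (intro borel_measurable_continuous_onI smooth_term_continuous smooth_term_partial_deriv assms)
  show ?thesis unfolding grad_norm_def by measurable
qed

text \<open>Both sides pass to the limit from the smooth approximants. A general index set
  \<open>I\<close> serves the whole sum and, with \<open>I = {i}\<close>, functions of a single
  coordinate.\<close>

lemma additive_moment_inequality:
  assumes f: "\<And>x. (f has_real_derivative f' x) (at x)" and cont: "continuous_on UNIV f'"
    and growth: "\<And>x. \<bar>f' x\<bar> \<le> B * (1 + x\<^sup>2) ^ m" and I: "I \<subseteq> {..<n}" and p: "2 \<le> p"
  shows "(\<integral>\<omega>. \<bar>(\<Sum>i\<in>I. f (X i \<omega>)) - (\<integral>\<omega>. (\<Sum>i\<in>I. f (X i \<omega>)) \<partial>M)\<bar> ^ p \<partial>M)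
    \<le> (L * sqrt (real p)) ^ p * (\<integral>\<omega>. (sqrt (\<Sum>i\<in>I. (f' (X i \<omega>))\<^sup>2)) ^ p \<partial>M)"
proof -
  obtain F F' A K where F: "\<And>k. smooth_on_line (F k)" "\<And>k x. (F k has_real_derivative F' k x) (at x)"
    "\<And>k x. \<bar>F k x\<bar> \<le> A * (1 + x\<^sup>2) ^ K" "\<And>k x. \<bar>F' k x\<bar> \<le> A * (1 + x\<^sup>2) ^ K"
    "\<And>x. (\<lambda>k. F k x) \<longlonglongrightarrow> f x" "\<And>x. (\<lambda>k. F' k x) \<longlonglongrightarrow> f' x"
    "\<And>k. continuous_on UNIV (F' k)"
    using smooth_approximating_sequence[OF f cont growth] by blast
  have cF: "continuous_on UNIV (F k)" "continuous_on UNIV f" for k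
    by (rule continuous_on_UNIV_if_DERIV, rule F f)+
  have iI: "i < n" if "i \<in> I" for i using I that by auto
  have rp: "(\<Sum>i\<in>I. \<phi> (random_point n X \<omega> i)) = (\<Sum>i\<in>I. \<phi> (X i \<omega>))" for \<phi> :: "real \<Rightarrow> real" and \<omega>
    by (intro sum.cong) (use iI in \<open>auto simp: random_point_def\<close>)
  define W where "W \<omega> = (\<Sum>i\<in>I. A * (1 + (X i \<omega>)\<^sup>2) ^ K)" for \<omega>
  have W: "all_moments M W"
    unfolding W_def by (intro all_moments_sum finite_measure_M all_moments_weight iI)
  define Y H where "Y k \<omega> = (\<Sum>i\<in>I. F k (X i \<omega>))" and "H k \<omega> = sqrt (\<Sum>i\<in>I. (F' k (X i \<omega>))\<^sup>2)" for k \<omega>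
  have mY: "all_moments M (Y k)" for k
    unfolding Y_def by (intro all_moments_sum finite_measure_M all_moments_growth[OF _ cF(1) F(3)] iI)
  have mH: "all_moments M (H k)" for k
    unfolding H_def by (intro all_moments_sqrt_sum_squares all_moments_growth[OF _ F(7) F(4)] iI)
  have meas_f: "(\<lambda>\<omega>. \<Sum>i\<in>I. f (X i \<omega>)) \<in> borel_measurable M"
    by (intro borel_measurable_sum measurable_compose[OF measurable_X] borel_measurable_continuous_onI cF iI)
  have meas_f': "(\<lambda>\<omega>. sqrt (\<Sum>i\<in>I. (f' (X i \<omega>))\<^sup>2)) \<in> borel_measurable M"
    by (intro measurable_compose[OF _ borel_measurable_sqrt] borel_measurable_sum borel_measurable_power
        measurable_compose[OF measurable_X] borel_measurable_continuous_onI cont iI)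
  have YW: "\<bar>Y k \<omega>\<bar> \<le> W \<omega>" for k \<omega>
    unfolding Y_def W_def by (rule order_trans[OF sum_abs]) (intro sum_mono F(3))
  \<comment> \<open>The Euclidean norm is at most the sum of absolute values, so the majorant of the
    sums also dominates the gradients.\<close>
  have HW: "\<bar>H k \<omega>\<bar> \<le> W \<omega>" for k \<omega>
  proof -
    have "H k \<omega> \<le> (\<Sum>i\<in>I. \<bar>F' k (X i \<omega>)\<bar>)"
      using L2_set_le_sum_abs[of "\<lambda>i. F' k (X i \<omega>)" I] by (simp add: L2_set_def H_def)
    also have "\<dots> \<le> W \<omega>" unfolding W_def by (intro sum_mono F(4))
    finally show ?thesis by (simp add: H_def sum_nonneg)
  qed
  have ineq: "(\<integral>\<omega>. \<bar>Y k \<omega> - (\<integral>\<omega>. Y k \<omega> \<partial>M)\<bar> ^ p \<partial>M) \<le> (L * sqrt (real p)) ^ p * (\<integral>\<omega>. \<bar>H k \<omega>\<bar> ^ p \<partial>M)" for k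
  proof -
    have s: "smooth_term (\<lambda>x. \<Sum>i\<in>I. F k (x i))"
      by (intro smooth_term_sum smooth_term.coord F)
    have gr: "grad_norm n (\<lambda>x. \<Sum>i\<in>I. F k (x i)) (random_point n X \<omega>) = H k \<omega>" for \<omega>
      unfolding H_def grad_norm_sum[OF F(2) I] by (simp add: rp[of "\<lambda>x. (F' k x)\<^sup>2"])
    show ?thesis
      using moment_inequality[OF s _ _ p] mY[of k] mH[of k]
      unfolding rp gr Y_def[symmetric] by simp
  qed
  have "(\<lambda>k. \<integral>\<omega>. \<bar>Y k \<omega> - (\<integral>\<omega>. Y k \<omega> \<partial>M)\<bar> ^ p \<partial>M) \<longlonglongrightarrow>
      (\<integral>\<omega>. \<bar>(\<Sum>i\<in>I. f (X i \<omega>)) - (\<integral>\<omega>. (\<Sum>i\<in>I. f (X i \<omega>)) \<partial>M)\<bar> ^ p \<partial>M)"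
    by (rule central_moment_tendsto[OF finite_measure_M W all_moments_measurable[OF mY] meas_f YW])
       (unfold Y_def, intro tendsto_sum F(5))
  moreover have "(\<lambda>k. \<integral>\<omega>. \<bar>H k \<omega>\<bar> ^ p \<partial>M) \<longlonglongrightarrow> (\<integral>\<omega>. \<bar>sqrt (\<Sum>i\<in>I. (f' (X i \<omega>))\<^sup>2)\<bar> ^ p \<partial>M)"
    by (rule integral_power_tendsto[OF W all_moments_measurable[OF mH] meas_f' HW])
       (unfold H_def, intro tendsto_real_sqrt tendsto_sum tendsto_power F(6))
  then have "(\<lambda>k. (L * sqrt (real p)) ^ p * (\<integral>\<omega>. \<bar>H k \<omega>\<bar> ^ p \<partial>M)) \<longlonglongrightarrow>
      (L * sqrt (real p)) ^ p * (\<integral>\<omega>. (sqrt (\<Sum>i\<in>I. (f' (X i \<omega>))\<^sup>2)) ^ p \<partial>M)"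
    by (intro tendsto_mult_left) (simp add: sum_nonneg)
  ultimately show ?thesis
    by (rule LIMSEQ_le) (intro exI allI impI ineq)
qed

text \<open>The Euclidean norm is not smooth at the origin; the hypothesis is applied to
  \<open>(e k + (\<Sum>i<n. F k (x i) * F k (x i))) powr (1 / 2)\<close> with \<open>e k\<close>
  tending to 0. The gradient bound for these functions is free of \<open>e k\<close>, so only
  \<open>f'\<close> survives on the right.\<close>

lemma euclidean_norm_moment_inequality:
  assumes f: "\<And>x. (f has_real_derivative f' x) (at x)" and cont: "continuous_on UNIV f'"
    and growth: "\<And>x. \<bar>f' x\<bar> \<le> B * (1 + x\<^sup>2) ^ m" and p: "2 \<le> p"
  defines "h \<equiv> \<lambda>\<omega>. sqrt (\<Sum>i<n. (f (X i \<omega>))\<^sup>2)"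
  shows "(\<integral>\<omega>. \<bar>h \<omega> - (\<integral>\<omega>. h \<omega> \<partial>M)\<bar> ^ p \<partial>M)
    \<le> (L * sqrt (real p)) ^ p * (\<Sum>i<n. \<integral>\<omega>. \<bar>f' (X i \<omega>)\<bar> ^ p \<partial>M)"
proof -
  obtain F F' A K where F: "\<And>k. smooth_on_line (F k)" "\<And>k x. (F k has_real_derivative F' k x) (at x)"
    "\<And>k x. \<bar>F k x\<bar> \<le> A * (1 + x\<^sup>2) ^ K" "\<And>k x. \<bar>F' k x\<bar> \<le> A * (1 + x\<^sup>2) ^ K"
    "\<And>x. (\<lambda>k. F k x) \<longlonglongrightarrow> f x" "\<And>x. (\<lambda>k. F' k x) \<longlonglongrightarrow> f' x"
    "\<And>k. continuous_on UNIV (F' k)"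
    using smooth_approximating_sequence[OF f cont growth] by blast
  have cF: "continuous_on UNIV (F k)" "continuous_on UNIV f" for k
    by (rule continuous_on_UNIV_if_DERIV, rule F f)+
  have rp: "(\<Sum>i<n. \<phi> (random_point n X \<omega> i)) = (\<Sum>i<n. \<phi> (X i \<omega>))" for \<phi> :: "real \<Rightarrow> real" and \<omega>
    by (intro sum.cong) (auto simp: random_point_def)
  define e where "e k = inverse (real (Suc k))" for k
  have e: "e k > 0" "e k \<le> 1" for k by (auto simp: e_def inverse_le_1_iff)
  \<comment> \<open>The summand 1 absorbs \<open>sqrt (e k)\<close>.\<close>
  define W where "W \<omega> = 1 + (\<Sum>i<n. A * (1 + (X i \<omega>)\<^sup>2) ^ K)" for \<omega>
  have W: "all_moments M W"
    unfolding W_def by (intro all_moments_add all_moments_const all_moments_sum finite_measure_M all_moments_weight) auto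
  define g where "g k x = (e k + (\<Sum>i<n. F k (x i) * F k (x i))) powr (1 / 2)" for k and x :: "nat \<Rightarrow> real"
  define H where "H k \<omega> = sqrt (e k + (\<Sum>i<n. (F k (X i \<omega>))\<^sup>2))" for k \<omega>
  have gH: "g k (random_point n X \<omega>) = H k \<omega>" for k \<omega>
    using e(1)[of k] by (simp add: g_def H_def rp[of "\<lambda>x. F k x * F k x"] powr_half_sqrt sum_nonneg power2_eq_square)
  have HW: "\<bar>H k \<omega>\<bar> \<le> W \<omega>" for k \<omega>
  proof -
    have "H k \<omega> \<le> sqrt (e k) + sqrt (\<Sum>i<n. (F k (X i \<omega>))\<^sup>2)"
      using e(1)[of k] unfolding H_def by (intro sqrt_add_le_add_sqrt sum_nonneg) auto
    also have "sqrt (e k) \<le> 1" using e(2)[of k] by simp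
    also have "sqrt (\<Sum>i<n. (F k (X i \<omega>))\<^sup>2) \<le> (\<Sum>i<n. \<bar>F k (X i \<omega>)\<bar>)"
      using L2_set_le_sum_abs[of "\<lambda>i. F k (X i \<omega>)"] by (simp add: L2_set_def)
    also have "(\<Sum>i<n. \<bar>F k (X i \<omega>)\<bar>) \<le> (\<Sum>i<n. A * (1 + (X i \<omega>)\<^sup>2) ^ K)"
      by (intro sum_mono F(3))
    finally show ?thesis using e(1)[of k] by (simp add: H_def W_def sum_nonneg)
  qed
  have mc: "(\<lambda>\<omega>. F k (X i \<omega>)) \<in> borel_measurable M" "(\<lambda>\<omega>. f (X i \<omega>)) \<in> borel_measurable M"
    "(\<lambda>\<omega>. f' (X i \<omega>)) \<in> borel_measurable M" if "i < n" for k i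
    by (rule measurable_compose[OF measurable_X[OF that]], rule borel_measurable_continuous_onI, rule cF cont)+
  have measH: "H k \<in> borel_measurable M" for k
    unfolding H_def
    by (intro measurable_compose[OF _ borel_measurable_sqrt] borel_measurable_add borel_measurable_sum
        borel_measurable_power borel_measurable_const mc) simp
  have meash: "h \<in> borel_measurable M"
    unfolding h_def
    by (intro measurable_compose[OF _ borel_measurable_sqrt] borel_measurable_sum
        borel_measurable_power mc) simp
  have mH: "all_moments M (H k)" for k
    using HW by (intro all_moments_dominated[OF W measH]) (auto intro: order_trans[OF _ abs_ge_self])
  have mF': "all_moments M (\<lambda>\<omega>. F' k (X i \<omega>))" if "i < n" for k i
    by (rule all_moments_growth[OF that F(7) F(4)])
  have s: "smooth_term (g k)" for k
    unfolding g_def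
    using e(1)[of k]
    by (intro smooth_term.pow smooth_term.add smooth_term.const smooth_term_sum smooth_term.mult smooth_term.coord F(1))
       (simp add: add_pos_nonneg sum_nonneg)
  have grad: "(grad_norm n (g k) (random_point n X \<omega>)) ^ q \<le> (\<Sum>i<n. \<bar>F' k (X i \<omega>)\<bar> ^ q)" if "q > 0" for k q \<omega>
    using grad_norm_sqrt_sum[OF F(2) e(1) that, of n k k "random_point n X \<omega>"]
    unfolding g_def rp[of "\<lambda>x. \<bar>F' k x\<bar> ^ q"] by simp
  have nn: "0 \<le> grad_norm n G x" for G x by (simp add: grad_norm_def sum_nonneg)
  have mG: "all_moments M (\<lambda>\<omega>. grad_norm n (g k) (random_point n X \<omega>))" for k
  proof (rule all_moments_dominated)
    show "all_moments M (\<lambda>\<omega>. \<Sum>i<n. \<bar>F' k (X i \<omega>)\<bar>)"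
      by (intro all_moments_sum finite_measure_M all_moments_abs mF') auto
    show "\<bar>grad_norm n (g k) (random_point n X \<omega>)\<bar> \<le> \<bar>\<Sum>i<n. \<bar>F' k (X i \<omega>)\<bar>\<bar>" for \<omega>
      using grad[of 1 k \<omega>] nn by simp
  qed (rule measurable_grad_norm[OF s])
  have ineq: "(\<integral>\<omega>. \<bar>H k \<omega> - (\<integral>\<omega>. H k \<omega> \<partial>M)\<bar> ^ p \<partial>M) \<le>
      (L * sqrt (real p)) ^ p * (\<Sum>i<n. \<integral>\<omega>. \<bar>F' k (X i \<omega>)\<bar> ^ p \<partial>M)" for k
  proof -
    have "(\<integral>\<omega>. \<bar>H k \<omega> - (\<integral>\<omega>. H k \<omega> \<partial>M)\<bar> ^ p \<partial>M) \<le>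
        (L * sqrt (real p)) ^ p * (\<integral>\<omega>. \<bar>grad_norm n (g k) (random_point n X \<omega>)\<bar> ^ p \<partial>M)"
      using moment_inequality[OF s[of k] _ mG p] mH[of k] by (simp add: gH)
    also have "(\<integral>\<omega>. \<bar>grad_norm n (g k) (random_point n X \<omega>)\<bar> ^ p \<partial>M) \<le>
        (\<integral>\<omega>. (\<Sum>i<n. \<bar>F' k (X i \<omega>)\<bar> ^ p) \<partial>M)"
    proof (rule integral_mono)
      show "integrable M (\<lambda>\<omega>. \<Sum>i<n. \<bar>F' k (X i \<omega>)\<bar> ^ p)"
        by (intro Bochner_Integration.integrable_sum all_moments_integrable_power[OF mF']) simp
      show "\<bar>grad_norm n (g k) (random_point n X \<omega>)\<bar> ^ p \<le> (\<Sum>i<n. \<bar>F' k (X i \<omega>)\<bar> ^ p)" for \<omega>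
        using grad[of p k \<omega>] p nn by simp
    qed (rule all_moments_integrable_power[OF mG])
    also have "\<dots> = (\<Sum>i<n. \<integral>\<omega>. \<bar>F' k (X i \<omega>)\<bar> ^ p \<partial>M)"
      by (intro Bochner_Integration.integral_sum all_moments_integrable_power[OF mF']) auto
    finally show ?thesis using L_pos by (simp add: mult_left_mono del: power_mult_distrib)
  qed
  have lim_e: "e \<longlonglongrightarrow> 0" unfolding e_def by (rule LIMSEQ_inverse_real_of_nat)
  have "(\<lambda>k. H k \<omega>) \<longlonglongrightarrow> sqrt (0 + (\<Sum>i<n. (f (X i \<omega>))\<^sup>2))" for \<omega>
    unfolding H_def by (intro tendsto_real_sqrt tendsto_add tendsto_sum tendsto_power lim_e F(5))
  then have "(\<lambda>k. \<integral>\<omega>. \<bar>H k \<omega> - (\<integral>\<omega>. H k \<omega> \<partial>M)\<bar> ^ p \<partial>M) \<longlonglongrightarrow>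
      (\<integral>\<omega>. \<bar>h \<omega> - (\<integral>\<omega>. h \<omega> \<partial>M)\<bar> ^ p \<partial>M)"
    by (intro central_moment_tendsto[OF finite_measure_M W measH meash HW]) (simp only: h_def add_0)
  moreover have "(\<lambda>k. \<integral>\<omega>. \<bar>F' k (X i \<omega>)\<bar> ^ p \<partial>M) \<longlonglongrightarrow> (\<integral>\<omega>. \<bar>f' (X i \<omega>)\<bar> ^ p \<partial>M)" if i: "i < n" for i
    by (rule integral_power_tendsto[OF all_moments_weight[OF i, of A K] all_moments_measurable[OF mF'[OF i]] mc(3)[OF i]])
       (rule F)+
  then have "(\<lambda>k. (L * sqrt (real p)) ^ p * (\<Sum>i<n. \<integral>\<omega>. \<bar>F' k (X i \<omega>)\<bar> ^ p \<partial>M)) \<longlonglongrightarrow>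
      (L * sqrt (real p)) ^ p * (\<Sum>i<n. \<integral>\<omega>. \<bar>f' (X i \<omega>)\<bar> ^ p \<partial>M)"
    by (intro tendsto_mult_left tendsto_sum) simp
  ultimately show ?thesis
    by (rule LIMSEQ_le) (intro exI allI impI ineq)
qed

end

section \<open>Iteration along the derivatives\<close>

text \<open>\<open>\<phi> d\<close> stands for the \<open>d\<close>-th derivative and
  \<open>S\<close> for a bound on the top one. Inductions along the chain run downward from order
  \<open>D\<close>.\<close>

locale derivative_chain = gradient_moments M n X L
  for M :: "'a measure" and n X L +
  fixes \<phi> :: "nat \<Rightarrow> real \<Rightarrow> real" and D :: nat and S :: real
  assumes chain: "\<And>d x. d < D \<Longrightarrow> (\<phi> d has_real_derivative \<phi> (Suc d) x) (at x)"
    and cont_top: "continuous_on UNIV (\<phi> D)"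
    and bound_top: "\<And>x. \<bar>\<phi> D x\<bar> \<le> S"
begin

lemma S_nonneg: "0 \<le> S"
  using bound_top[of 0] by simp

lemma chain_continuous: "d \<le> D \<Longrightarrow> continuous_on UNIV (\<phi> d)"
  using cont_top continuous_on_UNIV_if_DERIV[OF chain] by (cases "d = D") auto

lemma chain_growth:
  assumes "d \<le> D" obtains A K where "\<And>x. \<bar>\<phi> d x\<bar> \<le> A * (1 + x\<^sup>2) ^ K"
proof -
  have "\<exists>A K. \<forall>x. \<bar>\<phi> d x\<bar> \<le> A * (1 + x\<^sup>2) ^ K"
    using assms
  proof (induction rule: inc_induct)
    case base
    show ?case using bound_top by (intro exI[of _ S] exI[of _ 0]) simp
  next
    case (step d)
    then obtain A K where "\<And>x. \<bar>\<phi> (Suc d) x\<bar> \<le> A * (1 + x\<^sup>2) ^ K" by blast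
    then show ?case using polynomial_growth_antiderivative[OF chain] step by presburger
  qed
  then show thesis using that by blast
qed

lemma all_moments_chain: "i < n \<Longrightarrow> d \<le> D \<Longrightarrow> all_moments M (\<lambda>\<omega>. \<phi> d (X i \<omega>))"
  by (rule chain_growth[of d]) (auto intro: all_moments_growth chain_continuous)

text \<open>At the top order the supremum bound takes the place of the mean. One family then covers
  the first exponential of the result, with \<open>d = D\<close>, and the other two, with
  \<open>d < D\<close>.\<close>

definition coefficient :: "nat \<Rightarrow> nat \<Rightarrow> real" where
  "coefficient d i = (if d < D then \<bar>\<integral>\<omega>. \<phi> d (X i \<omega>) \<partial>M\<bar> else S)"

lemma coefficient_nonneg: "0 \<le> coefficient d i"
  using S_nonneg by (simp add: coefficient_def)

lemma central_moment_step:
  assumes i: "i < n" and d: "d < D" and p: "2 \<le> p"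
  shows "(\<integral>\<omega>. \<bar>\<phi> d (X i \<omega>) - (\<integral>\<omega>. \<phi> d (X i \<omega>) \<partial>M)\<bar> ^ p \<partial>M) \<le>
    (L * sqrt p) ^ p * (\<integral>\<omega>. \<bar>\<phi> (Suc d) (X i \<omega>)\<bar> ^ p \<partial>M)"
proof -
  have d': "Suc d \<le> D" using d by simp
  obtain A K where "\<And>x. \<bar>\<phi> (Suc d) x\<bar> \<le> A * (1 + x\<^sup>2) ^ K" using chain_growth[OF d'] by blast
  from additive_moment_inequality[OF chain[OF d] chain_continuous[OF d'] this _ p, of "{i}"] i
  show ?thesis by simp
qed

text \<open>Splitting off the mean costs \<open>2 ^ p\<close>, and the central moment is passed on
  to the next derivative with factor \<open>(L * sqrt p) ^ p\<close>; each order therefore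
  contributes \<open>(2 * (L * sqrt p)) ^ p\<close>. At order \<open>D\<close> a leading
  \<open>2 ^ p\<close> is added only to keep the summands uniform.\<close>

lemma moment_iteration:
  assumes i: "i < n" and p: "2 \<le> p" and d: "d \<le> D"
  shows "(\<integral>\<omega>. \<bar>\<phi> d (X i \<omega>)\<bar> ^ p \<partial>M) \<le>
    (\<Sum>k=d..D. 2 ^ p * ((2 * (L * sqrt p)) ^ p) ^ (k - d) * coefficient k i ^ p)"
  using d
proof (induction rule: inc_induct)
  case base
  have "(\<integral>\<omega>. \<bar>\<phi> D (X i \<omega>)\<bar> ^ p \<partial>M) \<le> (\<integral>\<omega>. S ^ p \<partial>M)"
    using bound_top all_moments_integrable_power[OF all_moments_chain[OF i order_refl]]
    by (intro integral_mono power_mono) auto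
  also have "\<dots> \<le> 2 ^ p * S ^ p"
    using S_nonneg mult_right_mono[of 1 "2 ^ p" "S ^ p"] by (simp add: prob_space)
  finally show ?case by (simp add: coefficient_def)
next
  case (step d)
  define l where "l = L * sqrt p"
  have l: "0 \<le> l" using L_pos by (simp add: l_def)
  define T where "T k = 2 ^ p * ((2 * l) ^ p) ^ (k - d) * coefficient k i ^ p" for k
  have T: "(2 * l) ^ p * (2 ^ p * ((2 * l) ^ p) ^ (k - Suc d) * coefficient k i ^ p) = T k" if "Suc d \<le> k" for k
  proof -
    have "k - d = Suc (k - Suc d)" using that by simp
    then show ?thesis by (simp add: T_def)
  qed
  have "(\<integral>\<omega>. \<bar>\<phi> d (X i \<omega>)\<bar> ^ p \<partial>M) \<le>
      2 ^ p * (coefficient d i ^ p + (\<integral>\<omega>. \<bar>\<phi> d (X i \<omega>) - (\<integral>\<omega>. \<phi> d (X i \<omega>) \<partial>M)\<bar> ^ p \<partial>M))"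
    using raw_moment_le[OF all_moments_chain[OF i, of d], of p] step by (simp add: coefficient_def)
  also have "\<dots> \<le> 2 ^ p * (coefficient d i ^ p + l ^ p * (\<integral>\<omega>. \<bar>\<phi> (Suc d) (X i \<omega>)\<bar> ^ p \<partial>M))"
    using central_moment_step[OF i step(2) p] by (intro mult_left_mono add_left_mono) (simp_all add: l_def)
  also have "\<dots> \<le> 2 ^ p * (coefficient d i ^ p +
      l ^ p * (\<Sum>k=Suc d..D. 2 ^ p * ((2 * l) ^ p) ^ (k - Suc d) * coefficient k i ^ p))"
    using step.IH l by (intro mult_left_mono add_left_mono) (simp_all add: l_def)
  also have "\<dots> = T d + (\<Sum>k=Suc d..D. (2 * l) ^ p * (2 ^ p * ((2 * l) ^ p) ^ (k - Suc d) * coefficient k i ^ p))"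
    by (simp only: T_def sum_distrib_left[symmetric]) (simp add: power_mult_distrib distrib_left)
  also have "\<dots> = T d + (\<Sum>k=Suc d..D. T k)"
    by (intro arg_cong2[of _ _ _ _ "(+)"] refl sum.cong T) auto
  also have "\<dots> = (\<Sum>k=d..D. T k)"
    using step(2) by (simp add: sum.atLeast_Suc_atMost)
  finally show ?case by (simp add: T_def l_def)
qed

text \<open>For exponent 2 the second moment is exactly squared mean plus variance, so the only
  factor per order is \<open>(L * sqrt 2)\<^sup>2\<close>.\<close>

lemma second_moment_iteration:
  assumes i: "i < n" and d: "d \<le> D"
  shows "(\<integral>\<omega>. (\<phi> d (X i \<omega>))\<^sup>2 \<partial>M) \<le> (\<Sum>k=d..D. (2 * L\<^sup>2) ^ (k - d) * (coefficient k i)\<^sup>2)"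
  using d
proof (induction rule: inc_induct)
  case base
  have "(\<integral>\<omega>. (\<phi> D (X i \<omega>))\<^sup>2 \<partial>M) \<le> (\<integral>\<omega>. S\<^sup>2 \<partial>M)"
    using bound_top all_moments_integrable_power[OF all_moments_chain[OF i order_refl], of 2] S_nonneg
    by (intro integral_mono) (auto simp: abs_le_square_iff[symmetric])
  then show ?case by (simp add: coefficient_def prob_space)
next
  case (step d)
  define T where "T k = (2 * L\<^sup>2) ^ (k - d) * (coefficient k i)\<^sup>2" for k
  have T: "2 * L\<^sup>2 * ((2 * L\<^sup>2) ^ (k - Suc d) * (coefficient k i)\<^sup>2) = T k" if "Suc d \<le> k" for k
  proof -
    have "k - d = Suc (k - Suc d)" using that by simp
    then show ?thesis by (simp add: T_def)
  qed
  have m: "all_moments M (\<lambda>\<omega>. \<phi> d (X i \<omega>))" using all_moments_chain[OF i, of d] step by simp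
  have "(\<integral>\<omega>. (\<phi> d (X i \<omega>))\<^sup>2 \<partial>M) = (coefficient d i)\<^sup>2 + variance (\<lambda>\<omega>. \<phi> d (X i \<omega>))"
    using variance_eq[OF all_moments_integrable[OF m]] all_moments_integrable_power[OF m, of 2] step
    by (simp add: coefficient_def)
  also have "\<dots> \<le> (coefficient d i)\<^sup>2 + 2 * L\<^sup>2 * (\<integral>\<omega>. (\<phi> (Suc d) (X i \<omega>))\<^sup>2 \<partial>M)"
    using central_moment_step[OF i step(2), of 2] by (simp add: power_mult_distrib mult.commute)
  also have "\<dots> \<le> (coefficient d i)\<^sup>2 + 2 * L\<^sup>2 * (\<Sum>k=Suc d..D. (2 * L\<^sup>2) ^ (k - Suc d) * (coefficient k i)\<^sup>2)"
    using step.IH by (intro mult_left_mono add_left_mono) simp_all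
  also have "\<dots> = T d + (\<Sum>k=Suc d..D. T k)"
    unfolding sum_distrib_left using T by (intro arg_cong2[of _ _ _ _ "(+)"] sum.cong) (auto simp: T_def)
  also have "\<dots> = (\<Sum>k=d..D. T k)"
    using step(2) by (simp add: sum.atLeast_Suc_atMost)
  finally show ?case by (simp add: T_def)
qed

text \<open>Interpolation of the \<open>p\<close>-norm between the maximum norm, bounded by
  \<open>\<tau>\<close>, and the Euclidean norm.\<close>

lemma sum_powers_le:
  fixes a :: "nat \<Rightarrow> real"
  assumes "\<And>i. i < n \<Longrightarrow> 0 \<le> a i \<and> a i \<le> \<tau>" "2 \<le> p"
  shows "(\<Sum>i<n. a i ^ p) \<le> \<tau> ^ (p - 2) * (\<Sum>i<n. (a i)\<^sup>2)"
proof -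
  have "a i ^ p \<le> \<tau> ^ (p - 2) * (a i)\<^sup>2" if "i < n" for i
  proof -
    have "a i ^ p = a i ^ (p - 2) * (a i)\<^sup>2"
      using assms(2) by (simp only: power_add[symmetric] le_add_diff_inverse2)
    also have "\<dots> \<le> \<tau> ^ (p - 2) * (a i)\<^sup>2"
      using assms(1)[OF that] by (intro mult_right_mono power_mono) auto
    finally show ?thesis .
  qed
  then show ?thesis unfolding sum_distrib_left by (intro sum_mono) simp
qed

text \<open>The hypothesis reduces the claim to the \<open>p\<close>-th moment of \<open>h\<close>,
  which is split into mean and fluctuation. The mean is controlled by second moments and
  \<open>H1\<close>. The fluctuation is controlled by the \<open>p\<close>-th moments of
  \<open>\<phi> 2 (X i)\<close>, where \<open>H1\<close> and \<open>H2\<close> are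
  interpolated.\<close>

lemma additive_central_moment_bound:
  assumes D: "1 \<le> D" and p: "2 \<le> p" and \<tau>: "0 \<le> \<tau>"
    and H1: "\<And>d. 1 \<le> d \<Longrightarrow> d \<le> D \<Longrightarrow> p * (L ^ (2 * d) * (\<Sum>i<n. (coefficient d i)\<^sup>2)) \<le> \<tau>\<^sup>2"
    and H2: "\<And>d i. 2 \<le> d \<Longrightarrow> d \<le> D \<Longrightarrow> i < n \<Longrightarrow> (L * sqrt p) ^ d * coefficient d i \<le> \<tau>"
  shows "(\<integral>\<omega>. \<bar>(\<Sum>i<n. \<phi> 0 (X i \<omega>)) - (\<integral>\<omega>. (\<Sum>i<n. \<phi> 0 (X i \<omega>)) \<partial>M)\<bar> ^ p \<partial>M)
    \<le> (4 * 8 ^ D * \<tau>) ^ p"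
proof -
  define l where "l = L * sqrt p"
  have l: "0 \<le> l" using L_pos by (simp add: l_def)
  have l2: "l ^ (2 * k) = real p ^ k * L ^ (2 * k)" for k
    by (simp add: l_def power_mult_distrib power_mult)
  define h where "h \<omega> = sqrt (\<Sum>i<n. (\<phi> 1 (X i \<omega>))\<^sup>2)" for \<omega>
  have mh: "all_moments M h"
    unfolding h_def using D by (intro all_moments_sqrt_sum_squares all_moments_chain) auto
  have h0: "0 \<le> h \<omega>" for \<omega> by (simp add: h_def sum_nonneg)
  have Eh0: "0 \<le> expectation h" using h0 by simp
  obtain A1 K1 where growth1: "\<And>x. \<bar>\<phi> (Suc 0) x\<bar> \<le> A1 * (1 + x\<^sup>2) ^ K1"
    using chain_growth[of "Suc 0"] D by auto
  have D0: "0 < D" using D by simp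
  have first: "(\<integral>\<omega>. \<bar>(\<Sum>i<n. \<phi> 0 (X i \<omega>)) - (\<integral>\<omega>. (\<Sum>i<n. \<phi> 0 (X i \<omega>)) \<partial>M)\<bar> ^ p \<partial>M)
      \<le> l ^ p * (\<integral>\<omega>. h \<omega> ^ p \<partial>M)"
    using additive_moment_inequality[OF chain[OF D0] chain_continuous growth1 order_refl p] D
    by (simp add: l_def h_def)
  show ?thesis
  \<comment> \<open>For \<open>D = 1\<close> no second derivative is available, but \<open>h\<close>
    is then bounded pointwise, and \<open>H1\<close> with \<open>d = 1\<close> bounds
    \<open>l * h\<close>.\<close>
  proof (cases "D = 1")
    case True
    have "l * h \<omega> \<le> \<tau>" for \<omega>
    proof (rule power2_le_imp_le)
      have "(l * h \<omega>)\<^sup>2 = p * (L\<^sup>2 * (\<Sum>i<n. (\<phi> 1 (X i \<omega>))\<^sup>2))"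
        using l2[of 1] by (simp add: h_def power_mult_distrib sum_nonneg)
      also have "\<dots> \<le> p * (L\<^sup>2 * (\<Sum>i<n. (coefficient 1 i)\<^sup>2))"
      proof (intro mult_left_mono sum_mono)
        have c: "coefficient 1 i = S" for i unfolding coefficient_def using True by simp
        show "(\<phi> 1 (X i \<omega>))\<^sup>2 \<le> (coefficient 1 i)\<^sup>2" for i
          using bound_top[of "X i \<omega>"] S_nonneg True unfolding c by (simp flip: abs_le_square_iff)
      qed auto
      also have "\<dots> \<le> \<tau>\<^sup>2" using H1[of 1] D by simp
      finally show "(l * h \<omega>)\<^sup>2 \<le> \<tau>\<^sup>2" .
    qed fact
    then have *: "l ^ p * h \<omega> ^ p \<le> \<tau> ^ p" for \<omega>
      using l h0 unfolding power_mult_distrib[symmetric] by (intro power_mono) auto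
    have "l ^ p * (\<integral>\<omega>. h \<omega> ^ p \<partial>M) = (\<integral>\<omega>. l ^ p * h \<omega> ^ p \<partial>M)" by simp
    also have "\<dots> \<le> (\<integral>\<omega>. \<tau> ^ p \<partial>M)"
      using all_moments_integrable_power[OF mh, of p] h0 * by (intro integral_mono) auto
    also have "\<dots> \<le> (4 * 8 ^ D * \<tau>) ^ p"
    proof -
      have "1 * \<tau> \<le> 4 * 8 ^ D * \<tau>"
        using \<tau> True by (intro mult_right_mono) auto
      then have "(1 * \<tau>) ^ p \<le> (4 * 8 ^ D * \<tau>) ^ p" using \<tau> by (intro power_mono) auto
      then show ?thesis by (simp add: prob_space)
    qed
    finally show ?thesis using first by simp
  next
    case False
    then have D2: "2 \<le> D" using D by simp
    obtain A2 K2 where growth2: "\<And>x. \<bar>\<phi> (Suc (Suc 0)) x\<bar> \<le> A2 * (1 + x\<^sup>2) ^ K2"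
      using chain_growth[of "Suc (Suc 0)"] D2 by auto
    have D1: "Suc 0 < D" using D2 by simp
    have second: "(\<integral>\<omega>. \<bar>h \<omega> - expectation h\<bar> ^ p \<partial>M) \<le> l ^ p * (\<Sum>i<n. \<integral>\<omega>. \<bar>\<phi> 2 (X i \<omega>)\<bar> ^ p \<partial>M)"
      using euclidean_norm_moment_inequality[OF chain[OF D1] chain_continuous growth2 p] D2
      by (simp add: l_def h_def[abs_def] numeral_2_eq_2)
    \<comment> \<open>By Jensen \<open>(E h)\<^sup>2\<close> is at most the sum of the second
      moments of \<open>\<phi> 1 (X i)\<close>. The factor \<open>l\<^sup>2 = p * L\<^sup>2\<close>
      supplies the single \<open>p\<close> of \<open>H1\<close>, and the geometric sum of the
      factors \<open>2 ^ (k - 1)\<close> is below \<open>2 ^ D\<close>.\<close>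
    have "l * expectation h \<le> 2 ^ D * \<tau>"
    proof (rule power2_le_imp_le)
      have h2: "integrable M (\<lambda>\<omega>. (h \<omega>)\<^sup>2)"
        using all_moments_integrable_power[OF mh, of 2] by simp
      have "(expectation h)\<^sup>2 \<le> expectation (\<lambda>\<omega>. (h \<omega>)\<^sup>2)"
        using variance_eq[OF all_moments_integrable[OF mh] h2] variance_positive[of h] by simp
      also have "\<dots> = (\<integral>\<omega>. (\<Sum>i<n. (\<phi> 1 (X i \<omega>))\<^sup>2) \<partial>M)"
        by (simp add: h_def sum_nonneg)
      also have "\<dots> = (\<Sum>i<n. \<integral>\<omega>. (\<phi> 1 (X i \<omega>))\<^sup>2 \<partial>M)"
        using all_moments_integrable_power[OF all_moments_chain[of _ 1], of _ 2] D
        by (intro Bochner_Integration.integral_sum) auto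
      also have "\<dots> \<le> (\<Sum>i<n. \<Sum>k=1..D. (2 * L\<^sup>2) ^ (k - 1) * (coefficient k i)\<^sup>2)"
        using D by (intro sum_mono second_moment_iteration) auto
      also have "\<dots> = (\<Sum>k=1..D. (2 * L\<^sup>2) ^ (k - 1) * (\<Sum>i<n. (coefficient k i)\<^sup>2))"
        by (subst sum.swap) (simp add: sum_distrib_left)
      finally have "(l * expectation h)\<^sup>2 \<le> l\<^sup>2 * (\<Sum>k=1..D. (2 * L\<^sup>2) ^ (k - 1) * (\<Sum>i<n. (coefficient k i)\<^sup>2))"
        by (simp only: power_mult_distrib) (intro mult_left_mono, auto)
      also have "\<dots> = (\<Sum>k=1..D. 2 ^ (k - 1) * (p * (L ^ (2 * k) * (\<Sum>i<n. (coefficient k i)\<^sup>2))))"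
      proof (subst sum_distrib_left, intro sum.cong refl)
        fix k assume "k \<in> {1..D}"
        then have "(L\<^sup>2) ^ k = L\<^sup>2 * (L\<^sup>2) ^ (k - 1)" by (cases k) auto
        then have "L ^ (2 * k) = L\<^sup>2 * (L\<^sup>2) ^ (k - 1)" by (simp only: power_mult)
        then show "l\<^sup>2 * ((2 * L\<^sup>2) ^ (k - 1) * (\<Sum>i<n. (coefficient k i)\<^sup>2)) =
            2 ^ (k - 1) * (p * (L ^ (2 * k) * (\<Sum>i<n. (coefficient k i)\<^sup>2)))"
          using l2[of 1] by (simp add: power_mult_distrib)
      qed
      also have "\<dots> \<le> (\<Sum>k=1..D. 2 ^ (k - 1) * \<tau>\<^sup>2)"
        using H1 by (intro sum_mono mult_left_mono) auto
      also have "\<dots> = (2 ^ D - 1) * \<tau>\<^sup>2"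
      proof -
        have "(\<Sum>k=1..D. 2 ^ (k - 1) :: real) = (\<Sum>k<D. 2 ^ k)"
          by (rule sum.reindex_bij_witness[of _ Suc "\<lambda>k. k - 1"]) auto
        then show ?thesis by (simp add: sum_distrib_right[symmetric] geometric_sum)
      qed
      also have "\<dots> \<le> (2 ^ D)\<^sup>2 * \<tau>\<^sup>2"
      proof (intro mult_right_mono)
        have "(1 :: real) \<le> 2 ^ D" by simp
        then have "(2 :: real) ^ D * 1 \<le> 2 ^ D * 2 ^ D" by (intro mult_left_mono) auto
        then show "(2 :: real) ^ D - 1 \<le> (2 ^ D)\<^sup>2" unfolding power2_eq_square by linarith
      qed simp
      finally show "(l * expectation h)\<^sup>2 \<le> (2 ^ D * \<tau>)\<^sup>2" by (simp add: power_mult_distrib)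
    qed (use \<tau> in simp)
    also have "\<dots> \<le> 8 ^ D * \<tau>"
      using \<tau> by (intro mult_right_mono power_mono) auto
    finally have mean: "(l * expectation h) ^ p \<le> (8 ^ D * \<tau>) ^ p"
      using l Eh0 by (intro power_mono) auto
    \<comment> \<open>Here \<open>l ^ (2 * k)\<close> contains \<open>p ^ k\<close>, of which
      \<open>H1\<close> accounts for one factor. The remaining \<open>p ^ (k - 1)\<close> is
      absorbed through \<open>p \<le> 2 ^ p\<close>, which costs only a constant after taking
      \<open>p\<close>-th roots.\<close>
    have coeff: "(\<Sum>i<n. (l ^ k * coefficient k i) ^ p) \<le> 2 ^ (p * (k - 1)) * \<tau> ^ p" if k: "2 \<le> k" "k \<le> D" for k
    proof -
      have "(\<Sum>i<n. (l ^ k * coefficient k i) ^ p) \<le> \<tau> ^ (p - 2) * (\<Sum>i<n. (l ^ k * coefficient k i)\<^sup>2)"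
        using l coefficient_nonneg H2[OF k] p by (intro sum_powers_le) (auto simp: l_def)
      also have "(\<Sum>i<n. (l ^ k * coefficient k i)\<^sup>2) = real p ^ (k - 1) * (p * (L ^ (2 * k) * (\<Sum>i<n. (coefficient k i)\<^sup>2)))"
      proof -
        have "(\<Sum>i<n. (l ^ k * coefficient k i)\<^sup>2) = l ^ (2 * k) * (\<Sum>i<n. (coefficient k i)\<^sup>2)"
          by (simp add: power_mult_distrib sum_distrib_left power_mult mult.commute[of 2])
        moreover have "real p ^ k = real p ^ (k - 1) * real p" using k by (cases k) auto
        ultimately show ?thesis using l2[of k] by simp
      qed
      also have "\<tau> ^ (p - 2) * \<dots> \<le> \<tau> ^ (p - 2) * ((2 ^ p) ^ (k - 1) * \<tau>\<^sup>2)"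
      proof (intro mult_left_mono mult_mono power_mono H1)
        show "real p \<le> 2 ^ p" using of_nat_less_two_power[of p, where 'a = real] by simp
      qed (use \<tau> k L_pos in \<open>auto intro!: mult_nonneg_nonneg sum_nonneg\<close>)
      also have "\<dots> = 2 ^ (p * (k - 1)) * \<tau> ^ p"
      proof -
        have "\<tau> ^ (p - 2) * \<tau>\<^sup>2 = \<tau> ^ p"
          using p by (simp only: power_add[symmetric] le_add_diff_inverse2)
        then show ?thesis by (simp only: power_mult mult.left_commute[of "\<tau> ^ (p - 2)"])
      qed
      finally show ?thesis .
    qed
    \<comment> \<open>One factor \<open>l ^ p\<close> comes from \<open>first\<close> and one from
      \<open>second\<close>; with the \<open>k - 2\<close> further steps of the iteration, order
      \<open>k\<close> receives \<open>l ^ (k * p)\<close>.\<close>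
    have "l ^ p * (l ^ p * (\<Sum>i<n. \<integral>\<omega>. \<bar>\<phi> 2 (X i \<omega>)\<bar> ^ p \<partial>M)) \<le>
        l ^ p * (l ^ p * (\<Sum>i<n. \<Sum>k=2..D. 2 ^ p * ((2 * l) ^ p) ^ (k - 2) * coefficient k i ^ p))"
      using l D2 p unfolding l_def by (intro mult_left_mono sum_mono moment_iteration) auto
    also have "\<dots> = (\<Sum>k=2..D. 2 ^ (p * (k - 1)) * (\<Sum>i<n. (l ^ k * coefficient k i) ^ p))"
      unfolding sum_distrib_left
    proof (subst sum.swap, intro sum.cong refl)
      fix k i assume "k \<in> {2..D}"
      then obtain j where j: "k = j + 2" by (metis add.commute atLeastAtMost_iff le_Suc_ex)
      have "(l ^ p) ^ j = (l ^ j) ^ p" "(2 ^ p :: real) ^ j = 2 ^ (p * j)"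
        by (simp_all add: mult.commute flip: power_mult)
      then show "l ^ p * (l ^ p * (2 ^ p * ((2 * l) ^ p) ^ (k - 2) * coefficient k i ^ p)) =
          2 ^ (p * (k - 1)) * (l ^ k * coefficient k i) ^ p"
        by (simp add: j power_mult_distrib power_add)
    qed
    also have "\<dots> \<le> (\<Sum>k=2..D. (4 ^ D) ^ p * \<tau> ^ p)"
    proof (intro sum_mono)
      fix k assume k: "k \<in> {2..D}"
      have "2 ^ (p * (k - 1)) * (\<Sum>i<n. (l ^ k * coefficient k i) ^ p) \<le> 2 ^ (p * (k - 1)) * (2 ^ (p * (k - 1)) * \<tau> ^ p)"
        using k by (intro mult_left_mono coeff) auto
      also have "\<dots> = 4 ^ (p * (k - 1)) * \<tau> ^ p"
        by (simp flip: power_mult_distrib)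
      also have "\<dots> \<le> 4 ^ (p * D) * \<tau> ^ p"
        using k \<tau> by (intro mult_right_mono power_increasing) auto
      finally show "2 ^ (p * (k - 1)) * (\<Sum>i<n. (l ^ k * coefficient k i) ^ p) \<le> (4 ^ D) ^ p * \<tau> ^ p"
        by (simp add: mult.commute[of p] flip: power_mult)
    qed
    \<comment> \<open>The number \<open>D - 1\<close> of summands is bounded by
      \<open>(2 ^ D) ^ p\<close>, so that the bases 2 and 4 combine to 8.\<close>
    also have "\<dots> \<le> (2 ^ D) ^ p * ((4 ^ D) ^ p * \<tau> ^ p)"
    proof -
      have "real (D - 1) \<le> real D" by simp
      also have "\<dots> \<le> 2 ^ D" by (intro less_imp_le of_nat_less_two_power)
      also have "\<dots> \<le> (2 ^ D) ^ p" using p by (intro self_le_power) auto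
      finally show ?thesis using \<tau> by (simp add: mult_right_mono)
    qed
    also have "\<dots> = (8 ^ D * \<tau>) ^ p"
    proof -
      have "(2 :: real) ^ D * 4 ^ D = 8 ^ D" by (simp flip: power_mult_distrib)
      then show ?thesis by (simp flip: power_mult_distrib mult.assoc)
    qed
    finally have tail: "l ^ p * (l ^ p * (\<Sum>i<n. \<integral>\<omega>. \<bar>\<phi> 2 (X i \<omega>)\<bar> ^ p \<partial>M)) \<le> (8 ^ D * \<tau>) ^ p" .
    \<comment> \<open>The final factor 4 has one 2 from splitting off the mean and one 2 from adding
      two equal bounds, as \<open>2 \<le> 2 ^ p\<close>.\<close>
    have "l ^ p * (\<integral>\<omega>. h \<omega> ^ p \<partial>M) \<le> l ^ p * (2 ^ p * (expectation h ^ p + (\<integral>\<omega>. \<bar>h \<omega> - expectation h\<bar> ^ p \<partial>M)))"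
      using raw_moment_le[OF mh, of p] h0 Eh0 l by (intro mult_left_mono) auto
    also have "\<dots> \<le> l ^ p * (2 ^ p * (expectation h ^ p + l ^ p * (\<Sum>i<n. \<integral>\<omega>. \<bar>\<phi> 2 (X i \<omega>)\<bar> ^ p \<partial>M)))"
      using second l by (intro mult_left_mono add_left_mono) auto
    also have "\<dots> = 2 ^ p * ((l * expectation h) ^ p + l ^ p * (l ^ p * (\<Sum>i<n. \<integral>\<omega>. \<bar>\<phi> 2 (X i \<omega>)\<bar> ^ p \<partial>M)))"
      by (simp add: power_mult_distrib algebra_simps)
    also have "\<dots> \<le> 2 ^ p * ((8 ^ D * \<tau>) ^ p + (8 ^ D * \<tau>) ^ p)"
      using mean tail by (intro mult_left_mono add_mono) auto
    also have "\<dots> = 2 * (2 ^ p * (8 ^ D * \<tau>) ^ p)" by simp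
    also have "\<dots> \<le> 2 ^ p * (2 ^ p * (8 ^ D * \<tau>) ^ p)"
      using p \<tau> self_le_power[of "2 :: real" p] by (intro mult_right_mono) auto
    also have "\<dots> = (4 * 8 ^ D * \<tau>) ^ p"
      by (simp flip: power_mult_distrib mult.assoc)
    finally show ?thesis using first by simp
  qed
qed

end

section \<open>Tail bounds\<close>

lemma exp_neg_le_inverse: "exp (- x) \<le> 1 / x" if "x > 0" for x :: real
proof -
  have "x \<le> exp x" using exp_ge_add_one_self[of x] by linarith
  then show ?thesis using that by (simp add: exp_minus divide_simps)
qed

text \<open>The product form also makes sense for \<open>b = 0\<close>, where the quotient may be
  infinite, so vanishing denominators need no separate treatment later.\<close>

lemma ereal_le_divideD:
  assumes "ereal r \<le> ereal a / ereal b" "0 \<le> a" "0 \<le> b"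
  shows "r * b \<le> a"
proof (cases "b = 0")
  case False
  then have "ereal a / ereal b = ereal (a / b)" by simp
  then show ?thesis using assms False by (simp add: pos_le_divide_eq)
qed (use assms in simp)

lemma exp_ereal_nonneg: "0 \<le> exp_ereal x"
  by (cases x) (simp_all add: exp_ereal_def)

section \<open>Markov's inequality and the choice of the moment\<close>

context derivative_chain begin

text \<open>\<open>\<tau>\<close> is chosen so that the moment bound
  \<open>4 * 8 ^ D * \<tau>\<close> equals \<open>t / exp 1\<close>; Markov's inequality for the
  \<open>p\<close>-th power then gives \<open>exp (- p)\<close>.\<close>

lemma tail_bound_at_moment:
  assumes D: "1 \<le> D" and p: "2 \<le> p" and t: "0 < t" and \<tau>: "\<tau> = t / (exp 1 * (4 * 8 ^ D))"
    and H1: "\<And>d. 1 \<le> d \<Longrightarrow> d \<le> D \<Longrightarrow> p * (L ^ (2 * d) * (\<Sum>i<n. (coefficient d i)\<^sup>2)) \<le> \<tau>\<^sup>2"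
    and H2: "\<And>d i. 2 \<le> d \<Longrightarrow> d \<le> D \<Longrightarrow> i < n \<Longrightarrow> (L * sqrt p) ^ d * coefficient d i \<le> \<tau>"
  shows "prob {\<omega> \<in> space M. \<bar>(\<Sum>i<n. \<phi> 0 (X i \<omega>)) - (\<integral>\<omega>. (\<Sum>i<n. \<phi> 0 (X i \<omega>)) \<partial>M)\<bar> \<ge> t} \<le> exp (- real p)"
proof -
  define Y where "Y \<omega> = (\<Sum>i<n. \<phi> 0 (X i \<omega>)) - (\<integral>\<omega>. (\<Sum>i<n. \<phi> 0 (X i \<omega>)) \<partial>M)" for \<omega>
  have Y: "all_moments M Y"
    unfolding Y_def by (intro all_moments_diff all_moments_sum all_moments_const finite_measure_M all_moments_chain) auto
  have \<tau>0: "0 \<le> \<tau>" using t by (simp add: \<tau>)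
  have "\<bar>Y \<omega>\<bar> \<ge> t \<longleftrightarrow> \<bar>Y \<omega>\<bar> ^ p \<ge> t ^ p" for \<omega>
    using t p by (simp add: power_mono_iff)
  then have "prob {\<omega> \<in> space M. \<bar>Y \<omega>\<bar> \<ge> t} = prob {\<omega> \<in> space M. \<bar>Y \<omega>\<bar> ^ p \<ge> t ^ p}" by simp
  also have "\<dots> \<le> (\<integral>\<omega>. \<bar>Y \<omega>\<bar> ^ p \<partial>M) / t ^ p"
    using all_moments_integrable_power[OF Y, of p] t
    by (intro integral_Markov_inequality_measure[where A = "space M"]) auto
  also have "\<dots> \<le> (4 * 8 ^ D * \<tau>) ^ p / t ^ p"
    using additive_central_moment_bound[OF D p \<tau>0 H1 H2] t
    by (intro divide_right_mono) (auto simp: Y_def)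
  also have "\<dots> = (4 * 8 ^ D * \<tau> / t) ^ p" by (simp only: power_divide)
  also have "4 * 8 ^ D * \<tau> / t = exp (- 1)" using t by (simp add: \<tau> exp_minus divide_simps)
  also have "exp (- 1) ^ p = exp (- real p)" by (simp flip: exp_of_nat_mult)
  finally show ?thesis by (simp add: Y_def)
qed

text \<open>\<open>\<eta>\<close> is a lower bound for all ratios in the exponents, and
  \<open>p\<close> is taken as a constant multiple of \<open>\<eta>\<close>, rounded down.\<close>

lemma tail_bound_at_level:
  assumes D: "1 \<le> D" and t: "0 < t" and \<eta>: "0 < \<eta>"
    and A1: "\<And>d. 1 \<le> d \<Longrightarrow> d \<le> D \<Longrightarrow> \<eta> * (L ^ (2 * d) * (\<Sum>i<n. (coefficient d i)\<^sup>2)) \<le> t\<^sup>2"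
    and A2: "\<And>d i. 2 \<le> d \<Longrightarrow> d \<le> D \<Longrightarrow> i < n \<Longrightarrow>
      \<eta> * (L\<^sup>2 * coefficient d i powr (2 / real d)) \<le> t powr (2 / real d)"
  shows "prob {\<omega> \<in> space M. \<bar>(\<Sum>i<n. \<phi> 0 (X i \<omega>)) - (\<integral>\<omega>. (\<Sum>i<n. \<phi> 0 (X i \<omega>)) \<partial>M)\<bar> \<ge> t}
    \<le> 2 * exp (- \<eta> / (4 * (exp 1 * (4 * 8 ^ D))\<^sup>2))"
proof -
  define b :: real where "b = exp 1 * (4 * 8 ^ D)"
  define c where "c = b\<^sup>2"
  have b: "1 \<le> b"
  proof -
    have "(1 :: real) * 1 \<le> exp 1 * (4 * 8 ^ D)"
      by (intro mult_mono) (auto intro: order_trans[OF one_le_power[of "8 :: real" D]])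
    then show ?thesis by (simp add: b_def)
  qed
  then have c: "0 < c" by (simp add: c_def)
  show ?thesis
  proof (cases "\<eta> < 2 * c")
    \<comment> \<open>For small \<open>\<eta>\<close> the right-hand side is at least 1, since
      \<open>exp (- 1 / 2) \<ge> 1 / 2\<close>.\<close>
    case True
    then have "\<eta> / (4 * c) \<le> 1 / 2" using c by (simp add: divide_simps)
    then have "1 / 2 \<le> exp (- \<eta> / (4 * c))"
      using exp_ge_add_one_self[of "- \<eta> / (4 * c)"] by simp
    then show ?thesis
      using prob_le_1 unfolding c_def b_def by (smt (verit) field_sum_of_halves)
  next
    case False
    \<comment> \<open>The largest integer with \<open>p * c \<le> \<eta>\<close>. As
      \<open>\<eta> / c \<ge> 2\<close>, it is at least 2, and rounding down keeps at least a
      quarter of \<open>\<eta> / c\<close>; this is the 4 in the constant.\<close>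
    define p where "p = nat \<lfloor>\<eta> / c\<rfloor>"
    have q: "2 \<le> \<eta> / c" using False c by (simp add: divide_simps)
    then have fl: "2 \<le> \<lfloor>\<eta> / c\<rfloor>" by (simp add: le_floor_iff)
    then have p: "2 \<le> p" unfolding p_def by linarith
    have rp: "real p = of_int \<lfloor>\<eta> / c\<rfloor>" using fl by (simp add: p_def)
    have p_le: "real p \<le> \<eta> / c" unfolding rp by (rule of_int_floor_le)
    have p_ge: "\<eta> / (4 * c) \<le> real p"
    proof -
      have "\<eta> / c - 1 \<le> real p" unfolding rp by linarith
      moreover have "\<eta> / (4 * c) = (\<eta> / c) / 4" by simp
      ultimately show ?thesis using q by linarith
    qed
    have pc: "real p * c \<le> \<eta>" using p_le c by (simp add: pos_le_divide_eq)
    have "prob {\<omega> \<in> space M. \<bar>(\<Sum>i<n. \<phi> 0 (X i \<omega>)) - (\<integral>\<omega>. (\<Sum>i<n. \<phi> 0 (X i \<omega>)) \<partial>M)\<bar> \<ge> t} \<le> exp (- real p)"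
    proof (rule tail_bound_at_moment[OF D p t, of "t / b"])
      show "t / b = t / (exp 1 * (4 * 8 ^ D))" by (simp add: b_def)
    next
      fix d assume d: "1 \<le> d" "d \<le> D"
      let ?a = "L ^ (2 * d) * (\<Sum>i<n. (coefficient d i)\<^sup>2)"
      have "0 \<le> ?a" using L_pos by (simp add: sum_nonneg)
      then have "(p * c) * ?a \<le> \<eta> * ?a" by (intro mult_right_mono pc)
      also have "\<dots> \<le> t\<^sup>2" by (rule A1[OF d])
      finally show "p * ?a \<le> (t / b)\<^sup>2"
        using c by (simp add: power_divide pos_le_divide_eq mult_ac flip: c_def)
    next
      fix d i assume d: "2 \<le> d" "d \<le> D" and i: "i < n"
      let ?m = "coefficient d i" and ?v = "(L * sqrt p * b) ^ d * coefficient d i"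
      have m: "0 \<le> ?m" by (rule coefficient_nonneg)
      have lb: "0 < L * sqrt p * b" using L_pos p b by simp
      have d0: "real d \<noteq> 0" using d by simp
      \<comment> \<open>The power \<open>2 / d\<close> turns the desired \<open>?v \<le> t\<close>
        into a condition linear in \<open>p\<close>, to which \<open>A2\<close> applies.\<close>
      have "?v powr (2 / d) = ((L * sqrt p * b) powr d) powr (2 / d) * ?m powr (2 / d)"
        by (simp only: powr_mult[of "(L * sqrt (real p) * b) ^ d"] powr_realpow[OF lb])
      also have "\<dots> = (L * sqrt p * b)\<^sup>2 * ?m powr (2 / d)"
        using lb d0 by (simp add: powr_powr powr_numeral)
      also have "\<dots> = (p * c) * (L\<^sup>2 * ?m powr (2 / d))"
        by (simp add: power_mult_distrib c_def)
      also have "\<dots> \<le> \<eta> * (L\<^sup>2 * ?m powr (2 / d))"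
        by (intro mult_right_mono pc) simp
      also have "\<dots> \<le> t powr (2 / d)" by (rule A2[OF d i])
      finally have "\<not> t powr (2 / d) < ?v powr (2 / d)" by simp
      moreover have "t powr (2 / d) < ?v powr (2 / d)" if "t < ?v"
        using t d that by (intro powr_less_mono2) auto
      ultimately have v: "?v \<le> t" using not_le by blast
      \<comment> \<open>\<open>?v\<close> contains \<open>b ^ d\<close>, which covers the single
        factor \<open>b\<close> from \<open>\<tau> = t / b\<close> because
        \<open>b \<ge> 1\<close>.\<close>
      have "(L * sqrt p) ^ d * ?m * b \<le> (L * sqrt p) ^ d * ?m * b ^ d"
        using b d L_pos m by (intro mult_left_mono self_le_power) auto
      also have "\<dots> = ?v" by (simp add: power_mult_distrib)
      finally show "(L * sqrt p) ^ d * ?m \<le> t / b"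
        using v b by (simp add: pos_le_divide_eq)
    qed
    also have "exp (- real p) \<le> exp (- \<eta> / (4 * c))" using p_ge by simp
    also have "\<dots> \<le> 2 * exp (- \<eta> / (4 * c))" by simp
    finally show ?thesis by (simp add: c_def b_def)
  qed
qed

end

text \<open>The probability is bounded by one exponential whose exponent is the smallest of the
  three. That exponential is one of the three summands, and the other two are nonnegative.\<close>

lemma concentration_bound_if_moment_gradient_inequality:
  fixes M :: "'a measure"
  assumes D: "1 \<le> D" and "prob_space M" and n: "1 \<le> n" and X: "\<And>i. i < n \<Longrightarrow> X i \<in> borel_measurable M"
    and L: "L > 0" and ineq: "moment_gradient_inequality M n X L"
    and f: "continuously_differentiable D f" and bd: "bounded (range ((deriv ^^ D) f))" and t: "t > 0"
  shows "concentration_bound D (4 * (exp 1 * (4 * 8 ^ D))\<^sup>2) M n X L f t"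
proof -
  interpret prob_space M by fact
  define S where "S = sup_norm ((deriv ^^ D) f)"
  have "bdd_above (range (\<lambda>x. \<bar>(deriv ^^ D) f x\<bar>))"
  proof -
    obtain B where "\<And>x. \<bar>(deriv ^^ D) f x\<bar> \<le> B" using bd unfolding bounded_iff by auto
    then show ?thesis by (intro bdd_aboveI[of _ B]) auto
  qed
  then have S: "\<bar>(deriv ^^ D) f x\<bar> \<le> S" for x
    unfolding S_def sup_norm_def by (rule cSUP_upper2) auto
  interpret derivative_chain M n X L "\<lambda>d. (deriv ^^ d) f" D S
  proof unfold_locales
    show "((deriv ^^ d) f has_real_derivative (deriv ^^ Suc d) f x) (at x)" if "d < D" for d x
      using f that unfolding continuously_differentiable_def
      by (simp add: DERIV_deriv_iff_real_differentiable)
  qed (use X L ineq f S in \<open>auto simp: continuously_differentiable_def\<close>)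
  define C :: real where "C = 4 * (exp 1 * (4 * 8 ^ D))\<^sup>2"
  have C: "0 < C" by (simp add: C_def)
  define P where "P = prob {\<omega> \<in> space M. \<bar>(\<Sum>i<n. f (X i \<omega>)) - (\<integral>\<omega>'. (\<Sum>i<n. f (X i \<omega>')) \<partial>M)\<bar> \<ge> t}"
  define m where "m d i = (\<integral>\<omega>. (deriv ^^ d) f (X i \<omega>) \<partial>M)" for d i
  define E1 where "E1 = min (ereal (t ^ 2) / ereal (L ^ (2 * D) * real n * S ^ 2))
      (ereal (t powr (2 / real D)) / ereal (L ^ 2 * S powr (2 / real D)))"
  define E2 where "E2 = (INF d\<in>{1..D - 1}. ereal (t ^ 2) / ereal (L ^ (2 * d) * (\<Sum>i<n. (m d i) ^ 2)))"
  define E3 where "E3 = (INF d\<in>{2..D - 1}. ereal (t powr (2 / real d)) /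
      ereal (L ^ 2 * (MAX i\<in>{..<n}. \<bar>m d i\<bar> powr (2 / real d))))"
  \<comment> \<open>A finite level below all three minima supplies the hypotheses of
    \<open>tail_bound_at_level\<close>: order \<open>D\<close> from \<open>E1\<close>, lower orders
    from \<open>E2\<close> and \<open>E3\<close>.\<close>
  have level: "P \<le> 2 * exp (- \<eta> / C)" if \<eta>: "0 < \<eta>" "ereal \<eta> \<le> E1" "ereal \<eta> \<le> E2" "ereal \<eta> \<le> E3" for \<eta>
  proof -
    have "prob {\<omega> \<in> space M. \<bar>(\<Sum>i<n. (deriv ^^ 0) f (X i \<omega>)) - (\<integral>\<omega>. (\<Sum>i<n. (deriv ^^ 0) f (X i \<omega>)) \<partial>M)\<bar> \<ge> t}
        \<le> 2 * exp (- \<eta> / (4 * (exp 1 * (4 * 8 ^ D))\<^sup>2))"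
    proof (rule tail_bound_at_level[OF D t \<eta>(1)])
      fix d assume d: "1 \<le> d" "d \<le> D"
      show "\<eta> * (L ^ (2 * d) * (\<Sum>i<n. (coefficient d i)\<^sup>2)) \<le> t\<^sup>2"
      proof (cases "d = D")
        case True
        have "ereal \<eta> \<le> ereal (t ^ 2) / ereal (L ^ (2 * D) * real n * S ^ 2)"
          using \<eta>(2) by (simp add: E1_def)
        from ereal_le_divideD[OF this] show ?thesis
          using True L by (simp add: coefficient_def mult_ac)
      next
        case False
        then have "d \<in> {1..D - 1}" using d by auto
        then have "ereal \<eta> \<le> ereal (t ^ 2) / ereal (L ^ (2 * d) * (\<Sum>i<n. (m d i) ^ 2))"
          using \<eta>(3) unfolding E2_def by (meson INF_lower order_trans)
        from ereal_le_divideD[OF this] show ?thesis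
          using False d L by (simp add: coefficient_def m_def sum_nonneg)
      qed
    next
      fix d i assume d: "2 \<le> d" "d \<le> D" and i: "i < n"
      show "\<eta> * (L\<^sup>2 * coefficient d i powr (2 / real d)) \<le> t powr (2 / real d)"
      proof (cases "d = D")
        case True
        have "ereal \<eta> \<le> ereal (t powr (2 / real D)) / ereal (L ^ 2 * S powr (2 / real D))"
          using \<eta>(2) by (simp add: E1_def)
        from ereal_le_divideD[OF this] show ?thesis
          using True by (simp add: coefficient_def)
      next
        case False
        let ?Max = "MAX i\<in>{..<n}. \<bar>m d i\<bar> powr (2 / real d)"
        have Max: "\<bar>m d i\<bar> powr (2 / real d) \<le> ?Max"
          using i by (intro Max_ge) auto
        then have "0 \<le> ?Max" using powr_ge_zero order_trans by blast
        have "d \<in> {2..D - 1}" using d False by auto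
        then have "ereal \<eta> \<le> ereal (t powr (2 / real d)) / ereal (L ^ 2 * ?Max)"
          using \<eta>(4) unfolding E3_def by (meson INF_lower order_trans)
        from ereal_le_divideD[OF this] have "\<eta> * (L ^ 2 * ?Max) \<le> t powr (2 / real d)"
          using \<open>0 \<le> ?Max\<close> by simp
        moreover have "\<eta> * (L ^ 2 * \<bar>m d i\<bar> powr (2 / real d)) \<le> \<eta> * (L ^ 2 * ?Max)"
          using \<eta>(1) Max by (intro mult_left_mono) auto
        moreover have "coefficient d i = \<bar>m d i\<bar>"
          using False d by (simp add: coefficient_def m_def)
        ultimately show ?thesis by simp
      qed
    qed
    then show ?thesis unfolding P_def C_def by simp
  qed
  define E where "E = min E1 (min E2 E3)"
  have P: "0 \<le> P" "P \<le> 1" by (simp_all add: P_def)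
  have "ereal P \<le> 2 * exp_ereal (- (ereal (1 / C) * E))"
  proof (cases E)
    case (real r)
    have "P \<le> 2 * exp (- r / C)"
    proof (cases "0 < r")
      case True
      have "ereal r \<le> E" by (simp add: real)
      then show ?thesis using level[OF True] by (simp add: E_def)
    next
      case False
      then have "1 \<le> exp (- r / C)" using C by (simp add: divide_nonpos_pos)
      then show ?thesis using P by linarith
    qed
    then show ?thesis by (simp add: real exp_ereal_def)
  next
    \<comment> \<open>Every positive level is admissible, so the probability vanishes. The level
      \<open>C * (2 / e)\<close> is chosen to make the bound at most \<open>e\<close>.\<close>
    case PInf
    have "P \<le> 0"
    proof (rule field_le_epsilon)
      fix e :: real assume e: "0 < e"
      have "ereal (C * (2 / e)) \<le> E" by (simp add: PInf)
      then have "P \<le> 2 * exp (- (C * (2 / e)) / C)"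
        using C e by (intro level) (auto simp: E_def)
      also have "- (C * (2 / e)) / C = - (2 / e)" using C by simp
      also have "2 * exp (- (2 / e)) \<le> 2 * (1 / (2 / e))"
        using e by (intro mult_left_mono exp_neg_le_inverse) auto
      finally show "P \<le> 0 + e" by simp
    qed
    then show ?thesis using C by (simp add: PInf exp_ereal_def)
  next
    case MInf
    then show ?thesis using C by (simp add: exp_ereal_def)
  qed
  also have "\<dots> \<le> 2 * exp_ereal (- (ereal (1 / C) * E1)) + 2 * exp_ereal (- (ereal (1 / C) * E2))
      + 2 * exp_ereal (- (ereal (1 / C) * E3))"
  proof -
    have nn: "0 \<le> 2 * exp_ereal x" for x by (simp add: exp_ereal_nonneg)
    have le: "a \<le> a + b + c" "b \<le> a + b + c" "c \<le> a + b + c" if "0 \<le> a" "0 \<le> b" "0 \<le> c" for a b c :: ereal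
      using that by (simp_all add: add_increasing add_increasing2 add_nonneg_nonneg)
    consider "E = E1" | "E = E2" | "E = E3" unfolding E_def by (metis min_def)
    then show ?thesis
      by cases (simp_all only: le[OF nn nn nn])
  qed
  finally show ?thesis
    unfolding concentration_bound_def Let_def C_def[symmetric] S_def[symmetric] m_def[symmetric]
      P_def[symmetric] E1_def[symmetric] E2_def[symmetric] E3_def[symmetric] .
qed

section \<open>Transfer to another sample space\<close>

lemma Lp_norm_distr:
  assumes "T \<in> measurable M N" "Y \<in> borel_measurable N"
  shows "Lp_norm (distr M N T) p Y = Lp_norm M p (\<lambda>\<omega>. Y (T \<omega>))"
proof -
  note [measurable] = assms
  have "(\<integral>\<^sup>+ x. ennreal (\<bar>Y x\<bar> powr p) \<partial>distr M N T) = (\<integral>\<^sup>+ \<omega>. ennreal (\<bar>Y (T \<omega>)\<bar> powr p) \<partial>M)"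
    by (rule nn_integral_distr) measurable
  then show ?thesis by (simp add: Lp_norm_def)
qed

text \<open>A smooth function is known to be continuous on the subspace only. Composition with the
  retraction that sets the coordinates from \<open>n\<close> on to 0 gives a continuous, hence Borel
  measurable, function on the whole space.\<close>

lemma continuous_Euclidean_space_retract:
  assumes "continuous_map (Euclidean_space n) euclideanreal g"
  shows "continuous_on UNIV (\<lambda>x. g (\<lambda>i. if i < n then x i else 0))"
proof -
  have "continuous_map euclidean euclideanreal (\<lambda>x :: nat \<Rightarrow> real. if i < n then x i else 0)" for i
    by (cases "i < n") simp_all
  then have "continuous_map euclidean (Euclidean_space n) (\<lambda>x i. if i < n then x i else 0)"
    unfolding Euclidean_space_def
    by (auto simp: continuous_map_in_subtopology continuous_map_componentwise_UNIV)
  from continuous_map_compose[OF this assms] show ?thesis by (simp add: o_def)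
qed

text \<open>Under the law of the vector the coordinate functions take the place of \<open>X\<close>.
  Truncating coordinates fixes every value of \<open>random_point n X\<close>, so both norms agree
  by change of variables.\<close>

lemma moment_gradient_inequality_distr:
  assumes X: "\<And>i. i < n \<Longrightarrow> X i \<in> borel_measurable M" and ineq: "moment_gradient_inequality M n X L"
  shows "moment_gradient_inequality (distr M borel (random_point n X)) n (\<lambda>i x. x i) L"
  unfolding moment_gradient_inequality_def
proof (intro allI impI)
  let ?T = "random_point n X" and ?r = "random_point n (\<lambda>i x. x i) :: (nat \<Rightarrow> real) \<Rightarrow> nat \<Rightarrow> real"
  let ?N = "distr M borel ?T"
  fix p :: real and g
  assume p: "2 \<le> p" and g: "smooth n g" and int: "integrable ?N (\<lambda>x. g (?r x))"
  have T: "?T \<in> borel_measurable M" by (rule measurable_random_point[OF X])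
  have r: "?r (?T \<omega>) = ?T \<omega>" for \<omega> by (auto simp: random_point_def)
  have r_eq: "?r x = (\<lambda>i. if i < n then x i else 0)" for x by (simp add: random_point_def)
  have meas [measurable]: "(\<lambda>x. g (?r x)) \<in> borel_measurable borel"
    using borel_measurable_integrable[OF int] by simp
  have [measurable]: "(\<lambda>x. partial_deriv i g (?r x)) \<in> borel_measurable borel" if "i < n" for i
  proof -
    have "continuous_map (Euclidean_space n) euclideanreal (foldr partial_deriv [i] g)"
      using g[unfolded smooth_def, rule_format, of "[i]"] that by simp
    then have "continuous_on UNIV (\<lambda>x. partial_deriv i g (?r x))"
      unfolding r_eq using continuous_Euclidean_space_retract by simp
    then show ?thesis by (rule borel_measurable_continuous_onI)
  qed
  have grad: "(\<lambda>x. grad_norm n g (?r x)) \<in> borel_measurable borel"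
    unfolding grad_norm_def by measurable
  have intM: "integrable M (\<lambda>\<omega>. g (?T \<omega>))"
    using integrable_distr[OF T int] by (simp add: r)
  have mean: "(\<integral>x. g (?r x) \<partial>?N) = (\<integral>\<omega>. g (?T \<omega>) \<partial>M)"
    using integral_distr[OF T meas] by (simp add: r)
  have "(\<lambda>x. g (?r x) - (\<integral>x. g (?r x) \<partial>?N)) \<in> borel_measurable borel" by measurable
  then show "Lp_norm ?N p (\<lambda>x. g (?r x) - (\<integral>x. g (?r x) \<partial>?N)) \<le>
      ennreal (L * sqrt p) * Lp_norm ?N p (\<lambda>x. grad_norm n g (?r x))"
    using ineq p g intM unfolding moment_gradient_inequality_def
    by (simp add: Lp_norm_distr[OF T] grad r mean)
qed

text \<open>Every quantity in the bound depends on the law of the vector only. Expectations of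
  derivatives occur for orders below \<open>D\<close>, where the derivative is continuous and so
  measurable.\<close>

lemma concentration_bound_distr:
  assumes X: "\<And>i. i < n \<Longrightarrow> X i \<in> borel_measurable M" and D: "1 \<le> D"
    and f: "continuously_differentiable D f"
  shows "concentration_bound D C (distr M borel (random_point n X)) n (\<lambda>i x. x i) L f t =
    concentration_bound D C M n X L f t"
proof -
  let ?T = "random_point n X"
  let ?N = "distr M borel ?T"
  have T [measurable]: "?T \<in> borel_measurable M" by (rule measurable_random_point[OF X])
  have cont: "continuous_on UNIV ((deriv ^^ d) f)" if "d < D" for d
    using f that unfolding continuously_differentiable_def
    by (intro differentiable_imp_continuous_on) (auto simp: differentiable_on_def intro: differentiable_at_withinI)
  have meas [measurable]: "(\<lambda>x. (deriv ^^ d) f (x i)) \<in> borel_measurable (borel :: (nat \<Rightarrow> real) measure)"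
    if "d < D" for d i
    using cont[OF that]
    by (intro borel_measurable_continuous_onI continuous_on_compose2[OF _ continuous_on_product_coordinates]) auto
  have measf [measurable]: "(\<lambda>x. f (x i)) \<in> borel_measurable (borel :: (nat \<Rightarrow> real) measure)" for i
    using meas[of 0 i] D by simp
  have TX: "?T \<omega> i = X i \<omega>" if "i < n" for \<omega> i using that by (simp add: random_point_def)
  have TS: "(\<Sum>i<n. f (?T \<omega> i)) = (\<Sum>i<n. f (X i \<omega>))" for \<omega>
    by (intro sum.cong) (auto simp: TX)
  have m: "(\<integral>x. (deriv ^^ d) f (x i) \<partial>?N) = (\<integral>\<omega>. (deriv ^^ d) f (X i \<omega>) \<partial>M)" if "d < D" "i < n" for d i
    using integral_distr[OF T meas[OF that(1), of i]] that(2) by (simp add: TX)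
  have Z: "(\<integral>x. (\<Sum>i<n. f (x i)) \<partial>?N) = (\<integral>\<omega>. (\<Sum>i<n. f (X i \<omega>)) \<partial>M)"
    by (subst integral_distr[OF T]) (simp_all add: TS)
  have P: "measure ?N {x \<in> space ?N. t \<le> \<bar>(\<Sum>i<n. f (x i)) - (\<integral>\<omega>. (\<Sum>i<n. f (X i \<omega>)) \<partial>M)\<bar>} =
      measure M {\<omega> \<in> space M. t \<le> \<bar>(\<Sum>i<n. f (X i \<omega>)) - (\<integral>\<omega>. (\<Sum>i<n. f (X i \<omega>)) \<partial>M)\<bar>}"
  proof -
    have "{x. t \<le> \<bar>(\<Sum>i<n. f (x i)) - (\<integral>\<omega>. (\<Sum>i<n. f (X i \<omega>)) \<partial>M)\<bar>} \<in> sets borel" by measurable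
    from measure_distr[OF T this] show ?thesis by (simp add: TS vimage_def Int_def conj_commute)
  qed
  have E2: "(INF d\<in>{1..D - 1}. ereal (t ^ 2) / ereal (L ^ (2 * d) * (\<Sum>i<n. (\<integral>x. (deriv ^^ d) f (x i) \<partial>?N) ^ 2))) =
      (INF d\<in>{1..D - 1}. ereal (t ^ 2) / ereal (L ^ (2 * d) * (\<Sum>i<n. (\<integral>\<omega>. (deriv ^^ d) f (X i \<omega>) \<partial>M) ^ 2)))"
  proof (rule INF_cong[OF refl])
    fix d assume "d \<in> {1..D - 1}"
    then have "d < D" using D by auto
    then have "(\<Sum>i<n. (\<integral>x. (deriv ^^ d) f (x i) \<partial>?N) ^ 2) = (\<Sum>i<n. (\<integral>\<omega>. (deriv ^^ d) f (X i \<omega>) \<partial>M) ^ 2)"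
      by (intro sum.cong) (simp_all add: m)
    then show "ereal (t ^ 2) / ereal (L ^ (2 * d) * (\<Sum>i<n. (\<integral>x. (deriv ^^ d) f (x i) \<partial>?N) ^ 2)) =
        ereal (t ^ 2) / ereal (L ^ (2 * d) * (\<Sum>i<n. (\<integral>\<omega>. (deriv ^^ d) f (X i \<omega>) \<partial>M) ^ 2))"
      by (simp only:)
  qed
  have E3: "(INF d\<in>{2..D - 1}. ereal (t powr (2 / real d)) /
        ereal (L ^ 2 * (MAX i\<in>{..<n}. \<bar>\<integral>x. (deriv ^^ d) f (x i) \<partial>?N\<bar> powr (2 / real d)))) =
      (INF d\<in>{2..D - 1}. ereal (t powr (2 / real d)) /
        ereal (L ^ 2 * (MAX i\<in>{..<n}. \<bar>\<integral>\<omega>. (deriv ^^ d) f (X i \<omega>) \<partial>M\<bar> powr (2 / real d))))"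
  proof (rule INF_cong[OF refl])
    fix d assume "d \<in> {2..D - 1}"
    then have "d < D" using D by auto
    then have "(\<lambda>i. \<bar>\<integral>x. (deriv ^^ d) f (x i) \<partial>?N\<bar> powr (2 / real d)) ` {..<n} =
        (\<lambda>i. \<bar>\<integral>\<omega>. (deriv ^^ d) f (X i \<omega>) \<partial>M\<bar> powr (2 / real d)) ` {..<n}"
      by (intro image_cong refl) (simp add: m)
    then show "ereal (t powr (2 / real d)) /
        ereal (L ^ 2 * (MAX i\<in>{..<n}. \<bar>\<integral>x. (deriv ^^ d) f (x i) \<partial>?N\<bar> powr (2 / real d))) =
        ereal (t powr (2 / real d)) /
        ereal (L ^ 2 * (MAX i\<in>{..<n}. \<bar>\<integral>\<omega>. (deriv ^^ d) f (X i \<omega>) \<partial>M\<bar> powr (2 / real d)))"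
      by (simp only:)
  qed
  show ?thesis
    unfolding concentration_bound_def Let_def Z P E2 E3 ..
qed

theorem corollary3p6:
  fixes D :: nat
  assumes "D \<ge> 1"
  shows "(\<exists>C. admissible_constant TYPE(nat \<Rightarrow> real) D C) \<and>
         (\<forall>C. admissible_constant TYPE(nat \<Rightarrow> real) D C \<longrightarrow> admissible_constant TYPE('a) D C)"
proof (intro conjI allI impI)
  \<comment> \<open>The 4 comes from rounding \<open>p\<close> down, and the square from
    \<open>\<tau> = t / (exp 1 * (4 * 8 ^ D))\<close> in Markov's inequality.\<close>
  have "admissible_constant TYPE(nat \<Rightarrow> real) D (4 * (exp 1 * (4 * 8 ^ D))\<^sup>2)"
    unfolding admissible_constant_def
    by (intro conjI allI impI concentration_bound_if_moment_gradient_inequality[OF assms]) simp_all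
  then show "\<exists>C. admissible_constant TYPE(nat \<Rightarrow> real) D C" ..
next
  fix C assume C: "admissible_constant TYPE(nat \<Rightarrow> real) D C"
  show "admissible_constant TYPE('a) D C"
    unfolding admissible_constant_def
  proof (intro conjI allI impI)
    show "0 < C" using C by (simp add: admissible_constant_def)
    fix M :: "'a measure" and n X L f and t :: real
    assume M: "prob_space M" and n: "1 \<le> n" and X: "\<forall>i<n. X i \<in> borel_measurable M" and L: "L > 0"
      and ineq: "moment_gradient_inequality M n X L"
      and f: "continuously_differentiable D f" "bounded (range ((deriv ^^ D) f))" and t: "t > 0"
    \<comment> \<open>The law of the vector lives on \<open>nat \<Rightarrow> real\<close>, so the
      given constant applies to it.\<close>
    let ?N = "distr M borel (random_point n X)"
    have X': "\<And>i. i < n \<Longrightarrow> X i \<in> borel_measurable M" using X by blast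
    have "prob_space ?N"
      using M measurable_random_point[OF X'] by (rule prob_space.prob_space_distr)
    moreover have "moment_gradient_inequality ?N n (\<lambda>i x. x i) L"
      by (rule moment_gradient_inequality_distr[OF X' ineq])
    moreover have "(\<lambda>x. x i) \<in> borel_measurable ?N" for i :: nat
      by (simp add: borel_measurable_continuous_onI)
    ultimately have "concentration_bound D C ?N n (\<lambda>i x. x i) L f t"
      using n L f t by (intro C[unfolded admissible_constant_def, THEN conjunct2, rule_format])
    then show "concentration_bound D C M n X L f t"
      using concentration_bound_distr[OF X' assms f(1)] by simp
  qed
qed

end
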